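(* Let $G$ be a triangle-free graph with matching number $t$. Then \[mis(G)\leq m(t):=\begin{cases}5^{t/2} & \text{if } t \text{ is even},\\ 2\cdot 5^{(t-1)/2} & \text{if } t \text{ is odd},\end{cases}\] with equality if and only if $G$ is isomorphic to a graph in $\mathcal{M}_t$, where for $t$ even $\mathcal{M}_t=\{\tfrac{t}{2}C_5\cup rK_1 : r\in\mathbb{N}\}$ and for $t$ odd $\mathcal{M}_t=\{K_{1,\ell}\cup \tfrac{t-1}{2}C_5\cup sK_1 : \ell\in\mathbb{Z}^+,\ s\in\mathbb{N}\}$.
   Context: All graphs are finite and simple. $mis(G)$ is the number of maximal independent sets of $G$. The matching number of $G$ is the maximum size of a matching of $G$. $C_5$ is the cycle on 5 vertices, $K_1$ a single vertex, $K_{1,\ell}$ the star with $\ell$ leaves. $G\cup H$ is the disjoint union, $kG$ the disjoint union of $k$ copies of $G$. $\mathbb{N}=\{0,1,2,\dots\}$ and $\mathbb{Z}^+=\{1,2,\dots\}$. *)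

theory Defs
  imports "Graph_Theory.Graph_Theory" "HOL-Library.Disjoint_Sets"
begin

text \<open>
  A finite simple graph is a \<open>pair_graph\<close>: a finite vertex set with a symmetric, irreflexive
  relation \<open>parcs\<close> on it, so that an edge \<open>uv\<close> is the pair of arcs \<open>(u, v)\<close> and \<open>(v, u)\<close>.
  In matchings, edges are counted once, as the two-element sets \<open>{u, v}\<close>.
\<close>

definition triangle_free :: "'a pair_pre_digraph \<Rightarrow> bool" where
  "triangle_free G \<longleftrightarrow>
     \<not> (\<exists>u v w. (u, v) \<in> parcs G \<and> (v, w) \<in> parcs G \<and> (u, w) \<in> parcs G)"

definition independent_set :: "'a pair_pre_digraph \<Rightarrow> 'a set \<Rightarrow> bool" where
  "independent_set G S \<longleftrightarrow> S \<subseteq> pverts G \<and> (\<forall>u\<in>S. \<forall>v\<in>S. (u, v) \<notin> parcs G)"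

definition maximal_independent_set :: "'a pair_pre_digraph \<Rightarrow> 'a set \<Rightarrow> bool" where
  "maximal_independent_set G S \<longleftrightarrow>
     independent_set G S \<and> (\<forall>T. independent_set G T \<longrightarrow> S \<subseteq> T \<longrightarrow> T = S)"

definition mis :: "'a pair_pre_digraph \<Rightarrow> nat" where
  "mis G = card {S. maximal_independent_set G S}"

definition edges :: "'a pair_pre_digraph \<Rightarrow> 'a set set" where
  "edges G = {{u, v} | u v. (u, v) \<in> parcs G}"

definition matching :: "'a pair_pre_digraph \<Rightarrow> 'a set set \<Rightarrow> bool" where
  "matching G M \<longleftrightarrow> M \<subseteq> edges G \<and> disjoint M"

definition matching_number :: "'a pair_pre_digraph \<Rightarrow> nat" where
  "matching_number G = Max (card ` {M. matching G M})"

definition single_vertex_graph :: "nat pair_pre_digraph" where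
  "single_vertex_graph = \<lparr> pverts = {0}, parcs = {} \<rparr>"

text \<open>The following is a cycle only for \<open>n \<ge> 3\<close>; it is only used with \<open>n = 5\<close>.\<close>

definition cycle_graph :: "nat \<Rightarrow> nat pair_pre_digraph" where
  "cycle_graph n = \<lparr> pverts = {..<n},
     parcs = {(u, v). u < n \<and> v < n \<and> (v = Suc u mod n \<or> u = Suc v mod n)} \<rparr>"

definition star_graph :: "nat \<Rightarrow> nat pair_pre_digraph" where
  "star_graph l = \<lparr> pverts = {..l}, parcs = {0} \<times> {1..l} \<union> {1..l} \<times> {0} \<rparr>"

text \<open>
  The disjoint union of a list of graphs: the vertices of the \<open>i\<close>-th graph are tagged with \<open>i\<close>.
  Disjoint unions of several copies of a graph arise from \<open>replicate\<close>.
\<close>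

definition disjoint_union :: "'a pair_pre_digraph list \<Rightarrow> (nat \<times> 'a) pair_pre_digraph" where
  "disjoint_union Gs = \<lparr>
     pverts = {(i, v). i < length Gs \<and> v \<in> pverts (Gs ! i)},
     parcs = {((i, u), (j, v)). i = j \<and> i < length Gs \<and> (u, v) \<in> parcs (Gs ! i)} \<rparr>"

definition mis_bound :: "nat \<Rightarrow> nat" where
  "mis_bound t = (if even t then 5 ^ (t div 2) else 2 * 5 ^ ((t - 1) div 2))"

definition extremal_graphs :: "nat \<Rightarrow> (nat \<times> nat) pair_pre_digraph set" where
  "extremal_graphs t =
     (if even t
      then {disjoint_union (replicate (t div 2) (cycle_graph 5) @ replicate r single_vertex_graph)
              | r. True}
      else {disjoint_union ([star_graph l] @ replicate ((t - 1) div 2) (cycle_graph 5)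
                @ replicate s single_vertex_graph)
              | l s. l \<ge> 1})"

text \<open>Between \<open>pair_graph\<close>s, \<open>digraph_iso\<close> is the usual isomorphism of simple graphs.\<close>

lemma digraph_iso_pair_graph_iff:
  assumes "pair_graph G" and "pair_graph H"
  shows "digraph_iso (with_proj G) (with_proj H) \<longleftrightarrow>
    (\<exists>f. bij_betw f (pverts G) (pverts H) \<and>
         (\<forall>u\<in>pverts G. \<forall>v\<in>pverts G. (f u, f v) \<in> parcs H \<longleftrightarrow> (u, v) \<in> parcs G))"
    (is "?L \<longleftrightarrow> ?R")
proof -
  interpret G: pair_graph G by fact
  interpret H: pair_graph H by fact
  show ?thesis
  proof
    assume ?L
    then obtain h where h: "pre_digraph.digraph_isomorphism (with_proj G) h"
      and H: "with_proj H = app_iso h (with_proj G)"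
      unfolding digraph_iso_def by blast
    let ?f = "iso_verts h"
    have V: "pverts H = ?f ` pverts G" and A: "parcs H = iso_arcs h ` parcs G"
      and t: "iso_tail h = fst" and hd: "iso_head h = snd"
      using H by (simp_all add: with_proj_def app_iso_def)
    have inj: "inj_on ?f (pverts G)"
      and arc: "\<And>a. a \<in> parcs G \<Longrightarrow> iso_arcs h a = (?f (fst a), ?f (snd a))"
      using h t hd unfolding pre_digraph.digraph_isomorphism_def
      by (auto simp: prod_eq_iff)
    have "(?f u, ?f v) \<in> parcs H \<longleftrightarrow> (u, v) \<in> parcs G"
      if uv: "u \<in> pverts G" "v \<in> pverts G" for u v
    proof
      assume "(?f u, ?f v) \<in> parcs H"
      then obtain a where a: "a \<in> parcs G" "iso_arcs h a = (?f u, ?f v)"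
        using A by auto
      then have "?f (fst a) = ?f u" "?f (snd a) = ?f v" using arc by auto
      moreover have "fst a \<in> pverts G" "snd a \<in> pverts G"
        using a(1) G.arc_fst_in_verts G.arc_snd_in_verts by auto
      ultimately have "a = (u, v)" using inj uv by (auto simp: inj_on_def prod_eq_iff)
      then show "(u, v) \<in> parcs G" using a by simp
    next
      assume "(u, v) \<in> parcs G"
      then show "(?f u, ?f v) \<in> parcs H" using A arc by force
    qed
    then show ?R using V inj by (auto simp: bij_betw_def intro!: exI[of _ ?f])
  next
    assume ?R
    then obtain f where f: "inj_on f (pverts G)" "pverts H = f ` pverts G"
      and A: "\<And>u v. u \<in> pverts G \<Longrightarrow> v \<in> pverts G \<Longrightarrow>
                (f u, f v) \<in> parcs H \<longleftrightarrow> (u, v) \<in> parcs G"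
      by (auto simp: bij_betw_def)
    let ?h = "\<lparr> iso_verts = f, iso_arcs = map_prod f f, iso_head = snd, iso_tail = fst \<rparr>"
    have "inj_on (map_prod f f) (parcs G)"
      using map_prod_inj_on[OF f(1) f(1)]
      by (rule inj_on_subset) (auto intro: G.in_arcsD1 G.in_arcsD2)
    then have "pre_digraph.digraph_isomorphism (with_proj G) ?h"
      using f G.wf_digraph by (simp add: pre_digraph.digraph_isomorphism_def)
    moreover have "parcs H = map_prod f f ` parcs G"
    proof (intro equalityI subsetI)
      fix a assume a: "a \<in> parcs H"
      then have "fst a \<in> f ` pverts G" "snd a \<in> f ` pverts G"
        using H.arc_fst_in_verts H.arc_snd_in_verts f(2) by auto
      then obtain u v where "a = (f u, f v)" "u \<in> pverts G" "v \<in> pverts G"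
        by (auto simp: prod_eq_iff)
      then show "a \<in> map_prod f f ` parcs G" using a A by force
    next
      fix a assume "a \<in> map_prod f f ` parcs G"
      then show "a \<in> parcs H" using A G.in_arcsD1 G.in_arcsD2 by fastforce
    qed
    then have "with_proj H = app_iso ?h (with_proj G)"
      using f by (simp add: with_proj_def app_iso_def)
    ultimately show ?L unfolding digraph_iso_def by blast
  qed
qed

lemma pair_graphI:
  assumes "finite (pverts G)" and "parcs G \<subseteq> pverts G \<times> pverts G"
    and "sym (parcs G)" and "irrefl (parcs G)"
  shows "pair_graph G"
proof -
  have "finite (parcs G)" using assms finite_subset by blast
  with assms show ?thesis
    by unfold_locales (auto simp: symmetric_def irrefl_def)
qed

lemma pair_graph_single_vertex_graph: "pair_graph single_vertex_graph"
  by (rule pair_graphI) (auto simp: single_vertex_graph_def sym_def irrefl_def)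

lemma pair_graph_cycle_graph: "n \<ge> 2 \<Longrightarrow> pair_graph (cycle_graph n)"
  by (rule pair_graphI) (auto simp: cycle_graph_def sym_def irrefl_def mod_Suc split: if_splits)

lemma pair_graph_star_graph: "pair_graph (star_graph l)"
  by (rule pair_graphI) (auto simp: star_graph_def sym_def irrefl_def)

lemma complete_bipartite_star_graph: "K\<^bsub>1,l\<^esub> (with_proj (star_graph l))"
  unfolding complete_bipartite_digraph_pair_def
  by (rule conjI, simp add: star_graph_def, rule exI[of _ "{0}"], rule exI[of _ "{1..l}"])
    (auto simp: star_graph_def)

lemma pair_graph_disjoint_union:
  assumes "\<And>G. G \<in> set Gs \<Longrightarrow> pair_graph G"
  shows "pair_graph (disjoint_union Gs)"
proof (rule pair_graphI)
  have G: "pair_graph (Gs ! i)" if "i < length Gs" for i using assms that by simp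
  have "finite (SIGMA i:{..<length Gs}. pverts (Gs ! i))"
    using G by (auto simp: pair_fin_digraph.pair_finite_verts pair_graph_def pair_digraph_def)
  then show "finite (pverts (disjoint_union Gs))"
    by (rule rev_finite_subset) (auto simp: disjoint_union_def)
  show "parcs (disjoint_union Gs)
      \<subseteq> pverts (disjoint_union Gs) \<times> pverts (disjoint_union Gs)"
  proof -
    have "u \<in> pverts (Gs ! i)" "v \<in> pverts (Gs ! i)"
      if "i < length Gs" "(u, v) \<in> parcs (Gs ! i)" for i u v
    proof -
      interpret pair_graph "Gs ! i" using G that(1) .
      show "u \<in> pverts (Gs ! i)" "v \<in> pverts (Gs ! i)"
        using that(2) in_arcsD1 in_arcsD2 by auto
    qed
    then show ?thesis by (auto simp: disjoint_union_def)
  qed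
  have "(v, u) \<in> parcs (Gs ! i)" "u \<noteq> v"
    if "i < length Gs" "(u, v) \<in> parcs (Gs ! i)" for i u v
  proof -
    interpret pair_graph "Gs ! i" using G that(1) .
    show "(v, u) \<in> parcs (Gs ! i)" using that(2) pair_sym_arcs
      by (simp add: symmetric_def symD)
    show "u \<noteq> v" using that(2) pair_no_loops by fastforce
  qed
  then show "sym (parcs (disjoint_union Gs))" "irrefl (parcs (disjoint_union Gs))"
    unfolding disjoint_union_def sym_def irrefl_def by auto blast
qed

lemma pair_graph_extremal_graphs:
  assumes "H \<in> extremal_graphs t"
  shows "pair_graph H"
proof -
  from assms obtain Gs where "H = disjoint_union Gs"
    and "set Gs \<subseteq> {cycle_graph 5, single_vertex_graph} \<union> range star_graph"
    by (fastforce simp: extremal_graphs_def split: if_splits)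
  then show ?thesis
    using pair_graph_cycle_graph[of 5] pair_graph_single_vertex_graph pair_graph_star_graph
    by (auto intro!: pair_graph_disjoint_union)
qed

end

theory Submission
  imports Defs
begin

text \<open>
  Induction on the vertex set, where \<open>mis(G) \<le> mis(G - v) + mis(G - N[v])\<close> for every vertex \<open>v\<close>.
  If \<open>v\<close> lies in all maximum matchings, both summands have a smaller matching number, and
  \<open>2 m(t - 1) \<le> m(t)\<close>, strictly for even \<open>t\<close>. If there is no such \<open>v\<close>, by Gallai's lemma every
  component \<open>C\<close> is factor-critical: \<open>|C| = 2k + 1\<close> and \<open>C - u\<close> has a perfect matching for all \<open>u\<close>.
  Then matching numbers after deletions in \<open>C\<close> are bounded by counting vertices, and
  branching gives a strict inequality unless \<open>C\<close> is a 5-cycle, which contributes the factor 5.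
\<close>

section \<open>Matchable sets\<close>

text \<open>The bound grows by a factor sqrt 5 per matching edge. A star gains only 2 for one edge,
  so a single leftover edge is tolerable but two are not: 2 * 2 < 5. A triangle would gain 3 for one
  edge. It is the smallest nontrivial factor-critical graph, and excluding it makes the 5-cycle the
  best block. The obstacle is a factor-critical component: deleting one of its vertices leaves the
  matching number unchanged, so plain branching gains nothing. Counting vertices helps: after
  deleting d of its 2k + 1 vertices at most k - floor(d/2) matching edges remain in it. Enough
  vertices must therefore disappear in each branch, which is why branches are combined in pairs
  until the deletions are large. All graphs in the induction are induced subgraphs of one fixed
  relation \<open>E\<close>, given by their vertex sets, so that deletion is set difference.\<close>

inductive perfectly_matchable :: "('a \<times> 'a) set \<Rightarrow> 'a set \<Rightarrow> bool" for E where
  empty: "perfectly_matchable E {}"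
| insert_edge: "perfectly_matchable E X \<Longrightarrow> (u, v) \<in> E \<Longrightarrow> u \<notin> X \<Longrightarrow> v \<notin> X
    \<Longrightarrow> perfectly_matchable E (insert u (insert v X))"

text \<open>Matching number of the subgraph induced on \<open>W\<close>. A matching is represented
  by the set of vertices it covers, twice as many as its edges, since the exchange argument only
  speaks of covered vertices.\<close>

definition nu :: "('a \<times> 'a) set \<Rightarrow> 'a set \<Rightarrow> nat" where
  "nu E W = Max (card ` {X. X \<subseteq> W \<and> perfectly_matchable E X}) div 2"

lemma perfectly_matchable_finite: "perfectly_matchable E X \<Longrightarrow> finite X"
  by (induction rule: perfectly_matchable.induct) auto

lemma perfectly_matchable_Un:
  assumes "perfectly_matchable E X" "perfectly_matchable E Y" "X \<inter> Y = {}"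
  shows "perfectly_matchable E (X \<union> Y)"
  using assms by (induction rule: perfectly_matchable.induct)
    (auto intro: perfectly_matchable.insert_edge)

locale simple_relation =
  fixes E :: "('a \<times> 'a) set"
  assumes E_sym: "(u, v) \<in> E \<Longrightarrow> (v, u) \<in> E"
    and E_irrefl: "(u, u) \<notin> E"
begin

abbreviation pm :: "'a set \<Rightarrow> bool" where "pm \<equiv> perfectly_matchable E"

lemma pm_even_card: "pm X \<Longrightarrow> even (card X)"
proof (induction rule: perfectly_matchable.induct)
  case (insert_edge X u v)
  then have "u \<noteq> v" using E_irrefl by auto
  with insert_edge show ?case
    using perfectly_matchable_finite[of E X] by simp
qed simp

text \<open>The inductive definition exposes only the edge added last. Here any vertex can be given
  that role, because removing the edge at \<open>x\<close> commutes with adding a disjoint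
  edge.\<close>

lemma pm_partner:
  assumes "pm X" "x \<in> X"
  shows "\<exists>y\<in>X. (x, y) \<in> E \<and> x \<noteq> y \<and> pm (X - {x, y})"
  using assms
proof (induction rule: perfectly_matchable.induct)
  case (insert_edge X u v)
  have uv: "u \<noteq> v" "(v, u) \<in> E" using insert_edge E_irrefl E_sym by auto
  consider "x = u" | "x = v" | "x \<in> X" using insert_edge by auto
  then show ?case
  proof cases
    case 1
    then have "insert u (insert v X) - {x, v} = X" using insert_edge by auto
    then show ?thesis using insert_edge uv 1 by (intro bexI[of _ v]) auto
  next
    case 2
    then have "insert u (insert v X) - {x, u} = X" using insert_edge by auto
    then show ?thesis using insert_edge uv 2 by (intro bexI[of _ u]) auto
  next
    case 3
    then obtain y where y: "y \<in> X" "(x, y) \<in> E" "x \<noteq> y" "pm (X - {x, y})"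
      using insert_edge by blast
    have "insert u (insert v X) - {x, y} = insert u (insert v (X - {x, y}))"
      using insert_edge y 3 by auto
    moreover have "pm (insert u (insert v (X - {x, y})))"
      using insert_edge y by (intro perfectly_matchable.insert_edge) auto
    ultimately show ?thesis using y by (intro bexI[of _ y]) auto
  qed
qed simp

lemma pm_edge: "(u, v) \<in> E \<Longrightarrow> pm {u, v}"
  using perfectly_matchable.insert_edge[OF perfectly_matchable.empty] by auto

text \<open>The exchange property of the matching matroid. The induction walks along the alternating
  path from \<open>v\<close>.\<close>

lemma pm_exchange:
  assumes "pm A" "pm B" "v \<in> A" "v \<notin> B"
  shows "(\<exists>u\<in>A - B. u \<noteq> v \<and> pm (insert v (insert u B))) \<or>
    (\<exists>u\<in>B - A. pm (insert u (A - {v})))"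
  using assms
proof (induction "card A" arbitrary: A B v rule: less_induct)
  case less
  obtain x where x: "x \<in> A" "(v, x) \<in> E" "v \<noteq> x" "pm (A - {v, x})"
    using pm_partner less.prems by blast
  show ?case
  proof (cases "x \<in> B")
    case False
    have "pm (insert v (insert x B))"
      using False less.prems x by (intro perfectly_matchable.insert_edge)
    then show ?thesis using False x by auto
  next
    case True
    obtain y where y: "y \<in> B" "(x, y) \<in> E" "x \<noteq> y" "pm (B - {x, y})"
      using pm_partner less.prems True by blast
    have vy: "v \<noteq> y" using y less.prems by auto
    show ?thesis
    proof (cases "y \<in> A")
      case False
      have "pm (insert y (insert x (A - {v, x})))"
        using False y x E_sym by (intro perfectly_matchable.insert_edge) auto
      moreover have "insert y (insert x (A - {v, x})) = insert y (A - {v})" using x by auto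
      ultimately show ?thesis using False y by auto
    next
      case True
      \<comment> \<open>The alternating path runs v, x, y: the edge vx is used by \<open>A\<close>
        and xy by \<open>B\<close>. Without them \<open>y\<close> is covered by \<open>?A\<close>
        but not by \<open>?B\<close>, so it takes the role of \<open>v\<close>.\<close>
      let ?A = "A - {v, x}" and ?B = "B - {x, y}"
      have "card ?A < card A"
        using less.prems perfectly_matchable_finite[of E A] by (intro psubset_card_mono) auto
      from less.hyps[OF this x(4) y(4), of y] True vy y
      consider u where "u \<in> ?A - ?B" "u \<noteq> y" "pm (insert y (insert u ?B))"
        | u where "u \<in> ?B - ?A" "pm (insert u (?A - {y}))" by auto
      then show ?thesis
      proof cases
        case (1 u)
        have "pm (insert v (insert x (insert y (insert u ?B))))"
          by (rule perfectly_matchable.insert_edge) (use 1 x y vy less.prems in auto)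
        moreover have "insert v (insert x (insert y (insert u ?B))) = insert v (insert u B)"
          using y \<open>x \<in> B\<close> by auto
        ultimately show ?thesis using 1 y by auto
      next
        case (2 u)
        have "pm (insert x (insert y (insert u (?A - {y}))))"
          by (rule perfectly_matchable.insert_edge) (use 2 x y vy less.prems in auto)
        moreover have "insert x (insert y (insert u (?A - {y}))) = insert u (A - {v})"
          using x y vy True by auto
        ultimately show ?thesis using 2 less.prems by auto
      qed
    qed
  qed
qed

text \<open>No edge within \<open>X\<close> crosses the boundary of \<open>C\<close>, so each
  matching edge lies on one side.\<close>

lemma pm_split:
  assumes "pm X" "\<And>x y. x \<in> X \<inter> C \<Longrightarrow> y \<in> X - C \<Longrightarrow> (x, y) \<notin> E"
  shows "pm (X \<inter> C) \<and> pm (X - C)"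
  using assms
proof (induction rule: perfectly_matchable.induct)
  case empty
  then show ?case by (simp add: perfectly_matchable.empty)
next
  case (insert_edge X u v)
  have IH: "pm (X \<inter> C)" "pm (X - C)" using insert_edge by auto
  have "u \<in> C \<longleftrightarrow> v \<in> C" using insert_edge.prems insert_edge.hyps E_sym by blast
  then consider "u \<in> C" "v \<in> C" | "u \<notin> C" "v \<notin> C" by auto
  then show ?case
    by cases (use IH insert_edge.hyps in \<open>auto simp: insert_Diff_if intro: perfectly_matchable.insert_edge\<close>)
qed

section \<open>Matching numbers of vertex subsets\<close>

lemma nu_witness:
  assumes "finite W"
  obtains X where "X \<subseteq> W" "pm X" "card X = 2 * nu E W"
proof -
  let ?S = "card ` {X. X \<subseteq> W \<and> pm X}"
  have "finite ?S" using assms by simp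
  moreover have "?S \<noteq> {}" using perfectly_matchable.empty by auto
  ultimately have "Max ?S \<in> ?S" by (rule Max_in)
  then obtain X where X: "X \<subseteq> W" "pm X" "card X = Max ?S" by auto
  then show thesis using that[of X] pm_even_card[of X] by (auto simp: nu_def)
qed

lemma card_le_nu:
  assumes "finite W" "X \<subseteq> W" "pm X"
  shows "card X \<le> 2 * nu E W"
proof -
  have "card X \<le> Max (card ` {X. X \<subseteq> W \<and> pm X})"
    using assms by (intro Max_ge) auto
  moreover obtain c where "card X = 2 * c" using pm_even_card[OF assms(3)] by (rule evenE)
  ultimately show ?thesis unfolding nu_def by simp
qed

lemma nu_mono:
  assumes "finite W" "U \<subseteq> W"
  shows "nu E U \<le> nu E W"
proof -
  obtain X where "X \<subseteq> U" "pm X" "card X = 2 * nu E U"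
    using assms finite_subset nu_witness by metis
  then show ?thesis using card_le_nu[of W X] assms by auto
qed

lemma nu_remove_edge:
  assumes "finite W" "u \<in> W" "v \<in> W" "(u, v) \<in> E"
  shows "nu E (W - {u, v}) < nu E W"
proof -
  obtain X where X: "X \<subseteq> W - {u, v}" "pm X" "card X = 2 * nu E (W - {u, v})"
    using assms nu_witness by (metis finite_Diff)
  have "u \<noteq> v" using assms E_irrefl by auto
  moreover have "pm (insert u (insert v X))"
    using X assms by (intro perfectly_matchable.insert_edge) auto
  moreover have "finite X" using X perfectly_matchable_finite by auto
  ultimately have "card X + 2 \<le> 2 * nu E W"
    using card_le_nu[of W "insert u (insert v X)"] X assms by (auto simp: subset_Diff_insert)
  then show ?thesis using X by simp
qed

end

section \<open>Maximal independent sets of induced subgraphs\<close>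

text \<open>Maximality is stated as domination, a condition on single vertices that is easy to
  follow through deletions and unions.\<close>

definition mis_sets :: "('a \<times> 'a) set \<Rightarrow> 'a set \<Rightarrow> 'a set set" where
  "mis_sets E W = {S. S \<subseteq> W \<and> (\<forall>u\<in>S. \<forall>v\<in>S. (u, v) \<notin> E) \<and>
     (\<forall>x\<in>W - S. \<exists>y\<in>S. (x, y) \<in> E)}"

lemma finite_mis_sets [simp]: "finite W \<Longrightarrow> finite (mis_sets E W)"
  by (rule finite_subset[of _ "Pow W"]) (auto simp: mis_sets_def)

lemma mis_sets_edgeless:
  assumes "\<And>u v. u \<in> W \<Longrightarrow> v \<in> W \<Longrightarrow> (u, v) \<notin> E"
  shows "mis_sets E W = {W}"
proof -
  have "S = W" if "S \<in> mis_sets E W" for S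
    using that assms unfolding mis_sets_def by blast
  moreover have "W \<in> mis_sets E W" using assms by (simp add: mis_sets_def)
  ultimately show ?thesis by blast
qed

definition separated :: "('a \<times> 'a) set \<Rightarrow> 'a set \<Rightarrow> 'a set \<Rightarrow> bool" where
  "separated E A B \<longleftrightarrow> A \<inter> B = {} \<and> (\<forall>a\<in>A. \<forall>b\<in>B. (a, b) \<notin> E \<and> (b, a) \<notin> E)"

text \<open>Dominating neighbours lie on the same side, so a choice on \<open>A\<close> and a choice
  on \<open>B\<close> combine freely.\<close>

lemma card_mis_sets_Un:
  assumes "separated E A B"
  shows "card (mis_sets E (A \<union> B)) = card (mis_sets E A) * card (mis_sets E B)"
proof -
  have sep: "A \<inter> B = {}" "\<And>a b. a \<in> A \<Longrightarrow> b \<in> B \<Longrightarrow> (a, b) \<notin> E \<and> (b, a) \<notin> E"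
    using assms by (auto simp: separated_def)
  have "bij_betw (\<lambda>(S, T). S \<union> T) (mis_sets E A \<times> mis_sets E B) (mis_sets E (A \<union> B))"
  proof (rule bij_betw_byWitness[where f' = "\<lambda>S. (S \<inter> A, S \<inter> B)"])
    show "(\<lambda>(S, T). S \<union> T) ` (mis_sets E A \<times> mis_sets E B) \<subseteq> mis_sets E (A \<union> B)"
    proof clarify
      fix S T assume S: "S \<in> mis_sets E A" and T: "T \<in> mis_sets E B"
      have "S \<subseteq> A" "T \<subseteq> B" using S T by (auto simp: mis_sets_def)
      then show "S \<union> T \<in> mis_sets E (A \<union> B)"
        using S T sep unfolding mis_sets_def by blast
    qed
    show "(\<lambda>S. (S \<inter> A, S \<inter> B)) ` mis_sets E (A \<union> B) \<subseteq> mis_sets E A \<times> mis_sets E B"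
    proof clarify
      fix S assume S: "S \<in> mis_sets E (A \<union> B)"
      have *: "S \<subseteq> A \<union> B" "\<And>u v. u \<in> S \<Longrightarrow> v \<in> S \<Longrightarrow> (u, v) \<notin> E"
        "\<And>x. x \<in> A \<union> B \<Longrightarrow> x \<notin> S \<Longrightarrow> \<exists>y\<in>S. (x, y) \<in> E"
        using S by (auto simp: mis_sets_def)
      have "\<exists>y\<in>S \<inter> A. (x, y) \<in> E" if "x \<in> A" "x \<notin> S" for x
        using *(3)[of x] *(1) that sep by auto
      moreover have "\<exists>y\<in>S \<inter> B. (x, y) \<in> E" if "x \<in> B" "x \<notin> S" for x
        using *(3)[of x] *(1) that sep by auto
      ultimately show "S \<inter> A \<in> mis_sets E A \<and> S \<inter> B \<in> mis_sets E B"
        using *(2) by (auto simp: mis_sets_def)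
    qed
  qed (use sep(1) in \<open>auto simp: mis_sets_def\<close>)
  from bij_betw_same_card[OF this] show ?thesis by (simp add: card_cartesian_product)
qed

context simple_relation
begin

abbreviation nbs :: "'a \<Rightarrow> 'a set" where "nbs v \<equiv> E `` {v}"
abbreviation cnbs :: "'a \<Rightarrow> 'a set" where "cnbs v \<equiv> insert v (nbs v)"
abbreviation num_mis :: "'a set \<Rightarrow> nat" where "num_mis W \<equiv> card (mis_sets E W)"

text \<open>A vertex outside the closed neighbourhood of \<open>v\<close> is not dominated by
  \<open>v\<close>, hence by the rest of \<open>S\<close>.\<close>

lemma mis_sets_containing:
  assumes "S \<in> mis_sets E W" "v \<in> S"
  shows "S \<in> insert v ` mis_sets E (W - cnbs v)"
proof -
  have S: "S \<subseteq> W" "\<And>u w. u \<in> S \<Longrightarrow> w \<in> S \<Longrightarrow> (u, w) \<notin> E"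
    "\<And>x. x \<in> W \<Longrightarrow> x \<notin> S \<Longrightarrow> \<exists>y\<in>S. (x, y) \<in> E"
    using assms by (auto simp: mis_sets_def)
  have "\<exists>y\<in>S - {v}. (x, y) \<in> E" if "x \<in> W" "x \<notin> S" "(v, x) \<notin> E" for x
    using S(3)[of x] that E_sym by blast
  then have "S - {v} \<in> mis_sets E (W - cnbs v)"
    using S assms by (auto simp: mis_sets_def)
  then show ?thesis using assms by (metis image_eqI insert_Diff)
qed

text \<open>A set avoiding \<open>v\<close> stays maximal in \<open>W - {v}\<close>. A maximal set
  of \<open>W - {v}\<close> need not dominate \<open>v\<close>, so in general this is only an
  inequality.\<close>

lemma num_mis_le_delete:
  assumes "finite W" "v \<in> W"
  shows "num_mis W \<le> num_mis (W - {v}) + num_mis (W - cnbs v)"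
proof -
  have "mis_sets E W \<subseteq> mis_sets E (W - {v}) \<union> insert v ` mis_sets E (W - cnbs v)"
  proof
    fix S assume S: "S \<in> mis_sets E W"
    show "S \<in> mis_sets E (W - {v}) \<union> insert v ` mis_sets E (W - cnbs v)"
    proof (cases "v \<in> S")
      case True
      then show ?thesis using mis_sets_containing[OF S] by simp
    next
      case False
      then have "S \<in> mis_sets E (W - {v})" using S by (simp add: mis_sets_def subset_Diff_insert)
      then show ?thesis by simp
    qed
  qed
  then have "num_mis W \<le> card (mis_sets E (W - {v}) \<union> insert v ` mis_sets E (W - cnbs v))"
    using assms by (intro card_mono) auto
  also have "\<dots> \<le> num_mis (W - {v}) + card (insert v ` mis_sets E (W - cnbs v))"
    by (rule card_Un_le)
  also have "\<dots> \<le> num_mis (W - {v}) + num_mis (W - cnbs v)"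
    using assms by (simp add: card_image_le)
  finally show ?thesis .
qed

text \<open>Every maximal independent set contains \<open>v\<close> or a neighbour dominating it.
  Sets with several such neighbours are counted repeatedly.\<close>

lemma num_mis_le_nbs:
  assumes "finite W" "v \<in> W"
  shows "num_mis W \<le> (\<Sum>u\<in>W \<inter> cnbs v. num_mis (W - cnbs u))"
proof -
  have "mis_sets E W \<subseteq> (\<Union>u\<in>W \<inter> cnbs v. insert u ` mis_sets E (W - cnbs u))"
  proof
    fix S assume S: "S \<in> mis_sets E W"
    have "\<exists>u\<in>S. u \<in> W \<inter> cnbs v"
    proof (cases "v \<in> S")
      case False
      then obtain u where "u \<in> S" "(v, u) \<in> E" using S assms unfolding mis_sets_def by blast
      moreover have "S \<subseteq> W" using S by (simp add: mis_sets_def)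
      ultimately show ?thesis by blast
    qed (use assms in blast)
    then obtain u where "u \<in> S" "u \<in> W \<inter> cnbs v" by blast
    then show "S \<in> (\<Union>u\<in>W \<inter> cnbs v. insert u ` mis_sets E (W - cnbs u))"
      using mis_sets_containing[OF S] by blast
  qed
  then have "num_mis W \<le> card (\<Union>u\<in>W \<inter> cnbs v. insert u ` mis_sets E (W - cnbs u))"
    using assms by (intro card_mono) auto
  also have "\<dots> \<le> (\<Sum>u\<in>W \<inter> cnbs v. card (insert u ` mis_sets E (W - cnbs u)))"
    using assms by (intro card_UN_le) auto
  also have "\<dots> \<le> (\<Sum>u\<in>W \<inter> cnbs v. num_mis (W - cnbs u))"
    using assms by (intro sum_mono) (simp add: card_image_le)
  finally show ?thesis .
qed

end

section \<open>Gallai's lemma\<close>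

context simple_relation
begin

text \<open>For distinct \<open>u\<close> and \<open>v\<close>: no maximum matching misses both. If
  every vertex is missed by some maximum matching, this is an equivalence relation, whose classes
  are used as components.\<close>

definition inseparable :: "'a set \<Rightarrow> 'a \<Rightarrow> 'a \<Rightarrow> bool" where
  "inseparable V u v \<longleftrightarrow> u = v \<or> nu E (V - {u, v}) < nu E V"

text \<open>Suppose a maximum matching \<open>A\<close> misses \<open>u\<close> and
  \<open>w\<close>, and let \<open>B\<close> be one that misses \<open>v\<close>. Then
  \<open>A\<close> covers \<open>v\<close>, and the exchange property either enlarges
  \<open>B\<close> beyond the maximum or replaces \<open>v\<close> in \<open>A\<close> by one vertex
  \<open>x\<close>, leaving \<open>v\<close> and one of \<open>u\<close>, \<open>w\<close>
  uncovered.\<close>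

lemma inseparable_trans:
  assumes "finite V" "\<And>v. v \<in> V \<Longrightarrow> nu E (V - {v}) = nu E V" "v \<in> V"
    and "inseparable V u v" "inseparable V v w"
  shows "inseparable V u w"
proof (rule ccontr)
  assume "\<not> inseparable V u w"
  then have uw: "u \<noteq> w" "nu E (V - {u, w}) \<ge> nu E V" by (auto simp: inseparable_def)
  obtain A where A: "A \<subseteq> V - {u, w}" "pm A" "card A = 2 * nu E (V - {u, w})"
    using nu_witness assms(1) by (metis finite_Diff)
  have missed: False if "X \<subseteq> V - {v, z}" "pm X" "card X \<ge> 2 * nu E V" "z = u \<or> z = w" "z \<noteq> v" for X z
    using card_le_nu[of "V - {v, z}" X] that assms uw
    by (auto simp: inseparable_def insert_commute)
  obtain B where B: "B \<subseteq> V - {v}" "pm B" "card B = 2 * nu E V"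
    using nu_witness[of "V - {v}"] assms by (metis finite_Diff)
  have fin: "finite A" "finite B" using A B perfectly_matchable_finite by auto
  have "v \<in> A"
    using missed[of A u] missed[of A w] A uw by auto
  moreover have "v \<notin> B" using B by auto
  ultimately consider x where "x \<in> A - B" "x \<noteq> v" "pm (insert v (insert x B))"
    | x where "x \<in> B - A" "pm (insert x (A - {v}))"
    using pm_exchange A B by meson
  then show False
  proof cases
    case (1 x)
    have "insert v (insert x B) \<subseteq> V" using 1 A B assms by auto
    then have "card (insert v (insert x B)) \<le> 2 * nu E V" using 1 assms card_le_nu by auto
    then show False using 1 B fin \<open>v \<notin> B\<close> by auto
  next
    case (2 x)
    \<comment> \<open>The new vertex \<open>x\<close> can equal only one of \<open>u\<close> and
      \<open>w\<close>; \<open>z\<close> is one that is still missed.\<close>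
    define z where "z = (if x = u then w else u)"
    have "v \<noteq> z" using A \<open>v \<in> A\<close> by (auto simp: z_def)
    have "card (insert x (A - {v})) = card A"
      using 2 fin \<open>v \<in> A\<close> card_Suc_Diff1[of A v] by simp
    moreover have "insert x (A - {v}) \<subseteq> V - {v, z}"
      using 2 A B uw by (auto simp: z_def)
    moreover have "z = u \<or> z = w" by (simp add: z_def)
    ultimately show False
      using missed[of "insert x (A - {v})" z] 2(2) A(3) uw(2) \<open>v \<noteq> z\<close> by simp
  qed
qed

text \<open>\<open>C\<close> is the class of \<open>r\<close>. Adjacent vertices are inseparable,
  since an edge could be added to a matching missing both ends; hence \<open>C\<close> is closed
  under adjacency in \<open>V\<close>. A maximum matching missing \<open>u\<close> in
  \<open>C\<close> covers the rest of the class, and by closedness within \<open>C\<close>. The last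
  inequality combines such a matching of \<open>C - {r}\<close> with a maximum one of
  \<open>V - C\<close>.\<close>

lemma gallai_component:
  assumes "finite V" "\<And>v. v \<in> V \<Longrightarrow> nu E (V - {v}) = nu E V" "r \<in> V"
  obtains C k where "r \<in> C" "C \<subseteq> V" "\<And>u v. u \<in> C \<Longrightarrow> v \<in> V \<Longrightarrow> (u, v) \<in> E \<Longrightarrow> v \<in> C"
    "card C = 2 * k + 1" "\<And>u. u \<in> C \<Longrightarrow> pm (C - {u})" "nu E (V - C) + k \<le> nu E V"
proof -
  define C where "C = {u\<in>V. inseparable V u r}"
  have r: "r \<in> C" and CV: "C \<subseteq> V" using assms by (auto simp: C_def inseparable_def)
  have sym: "inseparable V u v \<longleftrightarrow> inseparable V v u" for u v
    by (auto simp: inseparable_def insert_commute)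
  have closed: "v \<in> C" if "u \<in> C" "v \<in> V" "(u, v) \<in> E" for u v
  proof -
    have "inseparable V v u"
      using nu_remove_edge[of V v u] that assms CV E_sym by (auto simp: inseparable_def)
    then show ?thesis using that inseparable_trans[OF assms(1,2), of u v r] CV
      by (auto simp: C_def)
  qed
  have cover: "pm (C - {u})" if u: "u \<in> C" for u
  proof -
    have "nu E (V - {u}) = nu E V" using assms(2) u CV by auto
    then obtain A where A: "A \<subseteq> V - {u}" "pm A" "card A = 2 * nu E V"
      using nu_witness[of "V - {u}"] assms(1) by auto
    have "w \<in> A" if w: "w \<in> C" "w \<noteq> u" for w
    proof (rule ccontr)
      assume "w \<notin> A"
      then have "card A \<le> 2 * nu E (V - {u, w})" using A assms by (intro card_le_nu) auto
      then have "\<not> inseparable V u w" using A w by (auto simp: inseparable_def)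
      moreover have "inseparable V u w"
        using inseparable_trans[OF assms(1,2), of r u w] assms(3) sym w u by (auto simp: C_def)
      ultimately show False by blast
    qed
    then have AC: "A \<inter> C = C - {u}" using A by auto
    have "pm (A \<inter> C)" using pm_split[of A C] A closed CV by blast
    then show ?thesis using AC by simp
  qed
  obtain k where k: "card (C - {r}) = 2 * k"
    using cover[OF r] pm_even_card by (meson evenE)
  have fC: "finite C" using CV assms finite_subset by auto
  obtain X where X: "X \<subseteq> V - C" "pm X" "card X = 2 * nu E (V - C)"
    using nu_witness assms by (metis finite_Diff)
  have "pm ((C - {r}) \<union> X)" using cover[OF r] X by (intro perfectly_matchable_Un) auto
  then have "card ((C - {r}) \<union> X) \<le> 2 * nu E V" using X CV assms by (intro card_le_nu) auto
  moreover have "card ((C - {r}) \<union> X) = 2 * k + 2 * nu E (V - C)"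
    using X k fC perfectly_matchable_finite by (subst card_Un_disjoint) auto
  ultimately have "nu E (V - C) + k \<le> nu E V" by simp
  moreover have "card C = 2 * k + 1" using k fC r by (metis Suc_eq_plus1 card_Suc_Diff1)
  ultimately show thesis using that r CV closed cover by blast
qed

lemma nu_le_component:
  assumes "finite V" "C \<subseteq> V" "\<And>u v. u \<in> C \<Longrightarrow> v \<in> V \<Longrightarrow> (u, v) \<in> E \<Longrightarrow> v \<in> C" "W \<subseteq> V"
  shows "nu E W \<le> card (W \<inter> C) div 2 + nu E (V - C)"
proof -
  obtain X where X: "X \<subseteq> W" "pm X" "card X = 2 * nu E W"
    using nu_witness assms by (metis finite_subset)
  have "pm (X \<inter> C) \<and> pm (X - C)" using pm_split[of X C] X assms by blast
  moreover have "card (X - C) \<le> 2 * nu E (V - C)"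
    using calculation X assms by (intro card_le_nu) auto
  moreover have "card (X \<inter> C) \<le> card (W \<inter> C)"
    using X assms by (intro card_mono) (auto intro: finite_subset)
  moreover have "card X = card (X \<inter> C) + card (X - C)"
    using X perfectly_matchable_finite card_Int_Diff by blast
  ultimately show ?thesis using X by linarith
qed

end

section \<open>The extremal graphs\<close>

text \<open>Has the form of the right-hand side of \<open>digraph_iso_pair_graph_iff\<close>, with a
  vertex subset of \<open>E\<close> in place of a graph.\<close>

definition induced_copy :: "('a \<times> 'a) set \<Rightarrow> 'a set \<Rightarrow> 'b pair_pre_digraph \<Rightarrow> bool" where
  "induced_copy E W H \<longleftrightarrow> (\<exists>f. bij_betw f W (pverts H) \<and>
     (\<forall>u\<in>W. \<forall>v\<in>W. (f u, f v) \<in> parcs H \<longleftrightarrow> (u, v) \<in> E))"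

abbreviation mis_count :: "'b pair_pre_digraph \<Rightarrow> nat" where
  "mis_count H \<equiv> card (mis_sets (parcs H) (pverts H))"

lemma card_mis_sets_induced_copy:
  assumes "induced_copy E W H"
  shows "card (mis_sets E W) = mis_count H"
proof -
  obtain f where f: "inj_on f W" "f ` W = pverts H"
    and arcs: "\<And>u v. u \<in> W \<Longrightarrow> v \<in> W \<Longrightarrow> (f u, f v) \<in> parcs H \<longleftrightarrow> (u, v) \<in> E"
    using assms by (auto simp: induced_copy_def bij_betw_def)
  have img: "f ` S \<in> mis_sets (parcs H) (pverts H) \<longleftrightarrow> S \<in> mis_sets E W" if S: "S \<subseteq> W" for S
  proof -
    have "(\<forall>x\<in>pverts H - f ` S. \<exists>y\<in>f ` S. (x, y) \<in> parcs H) \<longleftrightarrow>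
        (\<forall>x\<in>W - S. \<exists>y\<in>S. (f x, f y) \<in> parcs H)"
    proof -
      have "pverts H - f ` S = f ` (W - S)"
        using f S by (metis inj_on_image_set_diff Diff_subset)
      then show ?thesis by simp
    qed
    also have "\<dots> \<longleftrightarrow> (\<forall>x\<in>W - S. \<exists>y\<in>S. (x, y) \<in> E)" using arcs S by blast
    finally have "(\<forall>x\<in>pverts H - f ` S. \<exists>y\<in>f ` S. (x, y) \<in> parcs H) \<longleftrightarrow>
      (\<forall>x\<in>W - S. \<exists>y\<in>S. (x, y) \<in> E)" .
    moreover have "(\<forall>u\<in>f ` S. \<forall>v\<in>f ` S. (u, v) \<notin> parcs H) \<longleftrightarrow>
      (\<forall>u\<in>S. \<forall>v\<in>S. (u, v) \<notin> E)" using arcs S by blast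
    ultimately show ?thesis using f(2) S by (auto simp: mis_sets_def)
  qed
  have "mis_sets (parcs H) (pverts H) = (`) f ` mis_sets E W"
  proof (intro equalityI subsetI)
    fix T assume T: "T \<in> mis_sets (parcs H) (pverts H)"
    then have "T \<subseteq> f ` W" using f by (auto simp: mis_sets_def)
    then obtain S where "S \<subseteq> W" "T = f ` S" by (meson subset_imageE)
    then show "T \<in> (`) f ` mis_sets E W" using img T by auto
  next
    fix T assume "T \<in> (`) f ` mis_sets E W"
    then obtain S where "S \<in> mis_sets E W" "T = f ` S" by blast
    moreover from this have "S \<subseteq> W" by (simp add: mis_sets_def)
    ultimately show "T \<in> mis_sets (parcs H) (pverts H)" using img by simp
  qed
  moreover have "inj_on ((`) f) (mis_sets E W)"
    using f(1) by (intro inj_onI) (metis (no_types, lifting) inj_on_image_eq_iff mem_Collect_eq mis_sets_def)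
  ultimately show ?thesis by (simp add: card_image)
qed

section \<open>Disjoint unions by recursion on the list, and counting in the building blocks\<close>

lemma pverts_disjoint_union_Cons:
  "pverts (disjoint_union (H # Hs)) =
    Pair 0 ` pverts H \<union> (\<lambda>p. (Suc (fst p), snd p)) ` pverts (disjoint_union Hs)"
    (is "?L = ?R")
proof -
  have "(i, v) \<in> ?L \<longleftrightarrow> (i, v) \<in> ?R" for i v
    by (cases i) (auto simp: disjoint_union_def image_iff)
  then show ?thesis by auto
qed

lemma parcs_disjoint_union_Cons:
  "((0, x), (0, y)) \<in> parcs (disjoint_union (H # Hs)) \<longleftrightarrow> (x, y) \<in> parcs H"
  "((0, x), (Suc j, y)) \<notin> parcs (disjoint_union (H # Hs))"
  "((Suc i, x), (0, y)) \<notin> parcs (disjoint_union (H # Hs))"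
  "((Suc i, x), (Suc j, y)) \<in> parcs (disjoint_union (H # Hs)) \<longleftrightarrow>
    ((i, x), (j, y)) \<in> parcs (disjoint_union Hs)"
  by (auto simp: disjoint_union_def)

text \<open>Prepending \<open>H\<close> shifts all other tags by one, so the isomorphism of
  \<open>B\<close> is composed with a shift and that of \<open>A\<close> receives tag 0.\<close>

lemma induced_copy_Cons:
  fixes H :: "'b pair_pre_digraph"
  assumes "separated E A B" "induced_copy E A H" "induced_copy E B (disjoint_union Hs)"
  shows "induced_copy E (A \<union> B) (disjoint_union (H # Hs))"
proof -
  obtain g where g: "bij_betw g A (pverts H)"
    "\<And>u v. u \<in> A \<Longrightarrow> v \<in> A \<Longrightarrow> (g u, g v) \<in> parcs H \<longleftrightarrow> (u, v) \<in> E"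
    using assms by (auto simp: induced_copy_def)
  obtain h where h: "bij_betw h B (pverts (disjoint_union Hs))"
    "\<And>u v. u \<in> B \<Longrightarrow> v \<in> B \<Longrightarrow> (h u, h v) \<in> parcs (disjoint_union Hs) \<longleftrightarrow> (u, v) \<in> E"
    using assms by (auto simp: induced_copy_def)
  have sep: "A \<inter> B = {}" "\<And>a b. a \<in> A \<Longrightarrow> b \<in> B \<Longrightarrow> (a, b) \<notin> E \<and> (b, a) \<notin> E"
    using assms by (auto simp: separated_def)
  let ?s = "\<lambda>p :: nat \<times> 'b. (Suc (fst p), snd p)"
  define f where "f = (\<lambda>x. if x \<in> A then (0, g x) else ?s (h x))"
  have "bij_betw (\<lambda>x. (0, g x)) A (Pair 0 ` pverts H)"
    using g(1) by (auto simp: bij_betw_def inj_on_def)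
  then have 1: "bij_betw f A (Pair 0 ` pverts H)"
    by (rule bij_betw_cong[THEN iffD1, rotated]) (simp add: f_def)
  have "bij_betw (?s \<circ> h) B (?s ` pverts (disjoint_union Hs))"
    using h(1) by (intro bij_betw_trans[OF h(1)]) (auto simp: bij_betw_def inj_on_def prod_eq_iff)
  then have 2: "bij_betw f B (?s ` pverts (disjoint_union Hs))"
    by (rule bij_betw_cong[THEN iffD1, rotated]) (use sep in \<open>auto simp: f_def\<close>)
  have "bij_betw f (A \<union> B) (pverts (disjoint_union (H # Hs)))"
    unfolding pverts_disjoint_union_Cons by (rule bij_betw_combine[OF 1 2]) auto
  moreover have "(f u, f v) \<in> parcs (disjoint_union (H # Hs)) \<longleftrightarrow> (u, v) \<in> E"
    if "u \<in> A \<union> B" "v \<in> A \<union> B" for u v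
    using that sep g(2) h(2) by (auto simp: f_def parcs_disjoint_union_Cons simp del: fst_conv)
  ultimately show ?thesis by (auto simp: induced_copy_def)
qed

lemma mis_count_disjoint_union_Nil: "mis_count (disjoint_union []) = 1"
  by (simp add: mis_sets_edgeless disjoint_union_def)

lemma mis_count_disjoint_union_Cons:
  "mis_count (disjoint_union (H # Hs)) = mis_count H * mis_count (disjoint_union Hs)"
proof -
  let ?U = "disjoint_union (H # Hs)" and ?s = "\<lambda>p. (Suc (fst p), snd p)"
  let ?A = "Pair 0 ` pverts H" and ?B = "?s ` pverts (disjoint_union Hs)"
  have "separated (parcs ?U) ?A ?B"
    by (auto simp: separated_def parcs_disjoint_union_Cons)
  then have "mis_count ?U = card (mis_sets (parcs ?U) ?A) * card (mis_sets (parcs ?U) ?B)"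
    by (simp add: card_mis_sets_Un pverts_disjoint_union_Cons)
  moreover have "induced_copy (parcs ?U) ?A H"
    unfolding induced_copy_def
    by (rule exI[of _ snd])
      (auto simp: bij_betw_def inj_on_def parcs_disjoint_union_Cons image_image)
  moreover have "induced_copy (parcs ?U) ?B (disjoint_union Hs)"
    unfolding induced_copy_def
    by (rule exI[of _ "\<lambda>p. (fst p - 1, snd p)"])
      (auto simp: bij_betw_def inj_on_def parcs_disjoint_union_Cons image_image)
  ultimately show ?thesis by (simp add: card_mis_sets_induced_copy)
qed

lemma mis_count_single_vertex: "mis_count single_vertex_graph = 1"
  by (simp add: mis_sets_edgeless single_vertex_graph_def)

text \<open>The two sets are the centre and the set of all leaves; the latter dominates the centre
  because \<open>l \<ge> 1\<close>.\<close>

lemma mis_count_star: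
  assumes "l \<ge> 1"
  shows "mis_count (star_graph l) = 2"
proof -
  have "mis_sets (parcs (star_graph l)) (pverts (star_graph l)) = {{0}, {1..l}}"
  proof (intro equalityI subsetI)
    fix S assume S: "S \<in> mis_sets (parcs (star_graph l)) (pverts (star_graph l))"
    have sub: "S \<subseteq> {..l}" using S by (auto simp: mis_sets_def star_graph_def)
    have max: "0 \<in> S" if "x \<in> {1..l}" "x \<notin> S" for x
    proof -
      have "x \<in> pverts (star_graph l) - S" using that by (auto simp: star_graph_def)
      then obtain y where "y \<in> S" "(x, y) \<in> parcs (star_graph l)"
        using S unfolding mis_sets_def by blast
      then show ?thesis using that by (auto simp: star_graph_def)
    qed
    have ind: "x = 0" if "0 \<in> S" "x \<in> S" for x
    proof -
      have "(0, x) \<notin> parcs (star_graph l)" using S that by (auto simp: mis_sets_def)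
      then show ?thesis using sub that by (auto simp: star_graph_def)
    qed
    show "S \<in> {{0}, {1..l}}"
    proof (cases "0 \<in> S")
      case True
      then have "S = {0}" using ind by blast
      then show ?thesis by simp
    next
      case False
      then have "x \<in> S \<longleftrightarrow> x \<in> {1..l}" for x
        using sub max[of x] by (cases x) auto
      then have "S = {1..l}" by blast
      then show ?thesis by simp
    qed
  next
    fix S assume "S \<in> {{0}, {1..l}}"
    then show "S \<in> mis_sets (parcs (star_graph l)) (pverts (star_graph l))"
      using assms by (auto simp: mis_sets_def star_graph_def)
  qed
  moreover have "{0} \<noteq> {1..l}" by (metis atLeastAtMost_iff insertI1 not_one_le_zero)
  ultimately show ?thesis by simp
qed

lemma cycle_graph_5:
  "pverts (cycle_graph 5) = {0, 1, 2, 3, 4}"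
  "parcs (cycle_graph 5) = {(0,1),(1,0),(1,2),(2,1),(2,3),(3,2),(3,4),(4,3),(4,0),(0,4)}"
proof -
  have lt: "{..<5} = {0, 1, 2, 3, 4 :: nat}" by auto
  then show "pverts (cycle_graph 5) = {0, 1, 2, 3, 4}" by (simp add: cycle_graph_def)
  have "parcs (cycle_graph 5) = Set.filter (\<lambda>(u, v). v = Suc u mod 5 \<or> u = Suc v mod 5)
      ({..<5} \<times> {..<5})"
    by (auto simp: cycle_graph_def)
  also have "\<dots> = {(0,1),(1,0),(1,2),(2,1),(2,3),(3,2),(3,4),(4,3),(4,0),(0,4)}"
    unfolding lt by code_simp
  finally show "parcs (cycle_graph 5) =
    {(0,1),(1,0),(1,2),(2,1),(2,3),(3,2),(3,4),(4,3),(4,0),(0,4)}" .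
qed

lemma mis_count_cycle_5: "mis_count (cycle_graph 5) = 5"
proof -
  have "mis_sets (parcs (cycle_graph 5)) (pverts (cycle_graph 5)) =
      Set.filter (\<lambda>S. (\<forall>u\<in>S. \<forall>v\<in>S. (u, v) \<notin> parcs (cycle_graph 5)) \<and>
        (\<forall>x\<in>pverts (cycle_graph 5) - S. \<exists>y\<in>S. (x, y) \<in> parcs (cycle_graph 5)))
      (Pow (pverts (cycle_graph 5)))"
    by (auto simp: mis_sets_def)
  also have "\<dots> = {{0, 2}, {0, 3}, {1, 3}, {1, 4}, {2, 4}}"
    unfolding cycle_graph_5 by code_simp
  finally have "mis_count (cycle_graph 5) = card {{0, 2}, {0, 3}, {1, 3}, {1, 4}, {2, 4 :: nat}}"
    by simp
  also have "\<dots> = 5" by code_simp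
  finally show ?thesis .
qed

section \<open>The bound and its equality cases\<close>

text \<open>With x a power of 5, every numerical comparison below becomes linear in x. The offset 3
  is the largest drop in matching number that occurs.\<close>

lemma mis_bound_cases:
  obtains x where "x > 0" "mis_bound n = x" "mis_bound (n + 1) = 2 * x" "mis_bound (n + 2) = 5 * x"
    "mis_bound (n + 3) = 10 * x" "even n"
  | x where "x > 0" "mis_bound n = 2 * x" "mis_bound (n + 1) = 5 * x" "mis_bound (n + 2) = 10 * x"
    "mis_bound (n + 3) = 25 * x" "odd n"
proof (cases "even n")
  case True
  then obtain c where "n = 2 * c" by (rule evenE)
  then show thesis using that(1)[of "5 ^ c"] by (simp add: mis_bound_def)
next
  case False
  then obtain c where "n = 2 * c + 1" by (rule oddE)
  then show thesis using that(2)[of "5 ^ c"] by (simp add: mis_bound_def)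
qed

text \<open>Strictness serves the equality cases: a subgraph attaining the bound for n while having
  matching number at most n must have matching number exactly n.\<close>

lemma mis_bound_strict_mono: "strict_mono mis_bound"
proof (rule strict_mono_Suc_iff[THEN iffD2], rule allI)
  fix n show "mis_bound n < mis_bound (Suc n)" by (cases n rule: mis_bound_cases) auto
qed

lemma mis_bound_mono: "m \<le> n \<Longrightarrow> mis_bound m \<le> mis_bound n"
  using mis_bound_strict_mono by (simp add: strict_mono_less_eq)

section \<open>The extremal structure inside a given relation\<close>

inductive c5_union :: "('a \<times> 'a) set \<Rightarrow> nat \<Rightarrow> 'a set \<Rightarrow> bool" for E where
  edgeless: "finite I \<Longrightarrow> (\<And>u v. u \<in> I \<Longrightarrow> v \<in> I \<Longrightarrow> (u, v) \<notin> E) \<Longrightarrow> c5_union E 0 I"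
| add_cycle: "c5_union E n W \<Longrightarrow> induced_copy E D (cycle_graph 5) \<Longrightarrow> separated E D W
    \<Longrightarrow> c5_union E (Suc n) (D \<union> W)"

text \<open>The family \<open>extremal_graphs\<close> described by vertex sets of \<open>E\<close>,
  so that the induction can add pieces without building isomorphisms; \<open>extremal_copy\<close>
  translates back.\<close>

definition extremal :: "('a \<times> 'a) set \<Rightarrow> nat \<Rightarrow> 'a set \<Rightarrow> bool" where
  "extremal E t V \<longleftrightarrow> (if even t then c5_union E (t div 2) V
     else (\<exists>S W l. V = S \<union> W \<and> separated E S W \<and> l \<ge> 1 \<and> induced_copy E S (star_graph l) \<and>
       c5_union E ((t - 1) div 2) W))"

lemma induced_copy_edgeless:
  assumes "finite I" "\<And>u v. u \<in> I \<Longrightarrow> v \<in> I \<Longrightarrow> (u, v) \<notin> E"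
  shows "\<exists>r. induced_copy E I (disjoint_union (replicate r single_vertex_graph))"
  using assms
proof (induction I rule: finite_induct)
  case empty
  have "induced_copy E {} (disjoint_union (replicate 0 single_vertex_graph))"
    by (auto simp: induced_copy_def disjoint_union_def bij_betw_def)
  then show ?case by blast
next
  case (insert x I)
  then obtain r where r: "induced_copy E I (disjoint_union (replicate r single_vertex_graph))"
    by auto
  have "induced_copy E {x} single_vertex_graph"
    unfolding induced_copy_def
    by (rule exI[of _ "\<lambda>_. 0"]) (use insert in \<open>auto simp: single_vertex_graph_def bij_betw_def\<close>)
  moreover have "separated E {x} I" using insert by (auto simp: separated_def)
  ultimately have "induced_copy E ({x} \<union> I)
      (disjoint_union (single_vertex_graph # replicate r single_vertex_graph))"
    using r by (intro induced_copy_Cons)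
  then show ?case by (intro exI[of _ "Suc r"]) simp
qed

lemma c5_union_copy:
  assumes "c5_union E n W"
  shows "\<exists>r. induced_copy E W (disjoint_union
    (replicate n (cycle_graph 5) @ replicate r single_vertex_graph))"
  using assms
proof (induction rule: c5_union.induct)
  case (edgeless I)
  then show ?case using induced_copy_edgeless[of I E] by simp
next
  case (add_cycle n W D)
  then obtain r where "induced_copy E W (disjoint_union
    (replicate n (cycle_graph 5) @ replicate r single_vertex_graph))" by blast
  from induced_copy_Cons[OF add_cycle.hyps(3,2) this] show ?case by auto
qed

lemma extremal_copy:
  assumes "extremal E t V"
  shows "\<exists>H\<in>extremal_graphs t. induced_copy E V H"
proof (cases "even t")
  case True
  then show ?thesis
    using assms c5_union_copy[of E "t div 2" V] by (auto simp: extremal_def extremal_graphs_def)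
next
  case False
  then obtain S W l where SW: "V = S \<union> W" "separated E S W" "l \<ge> 1"
    "induced_copy E S (star_graph l)" "c5_union E ((t - 1) div 2) W"
    using assms by (auto simp: extremal_def)
  then obtain r where "induced_copy E W (disjoint_union
    (replicate ((t - 1) div 2) (cycle_graph 5) @ replicate r single_vertex_graph))"
    using c5_union_copy by blast
  then have "induced_copy E V (disjoint_union (star_graph l #
    (replicate ((t - 1) div 2) (cycle_graph 5) @ replicate r single_vertex_graph)))"
    using SW induced_copy_Cons by blast
  then show ?thesis using False SW(3) by (auto simp: extremal_graphs_def)
qed

text \<open>Gives the direction of the equality statement that starts from a graph in the family:
  the counts 5, 2 and 1 of the blocks multiply.\<close>

lemma mis_count_extremal_graphs:
  assumes "H \<in> extremal_graphs t"
  shows "mis_count H = mis_bound t"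
proof -
  have r: "mis_count (disjoint_union (replicate r single_vertex_graph)) = 1" for r
    by (induction r)
      (simp_all add: mis_count_disjoint_union_Nil mis_count_disjoint_union_Cons mis_count_single_vertex)
  have n: "mis_count (disjoint_union (replicate n (cycle_graph 5) @
      replicate r single_vertex_graph)) = 5 ^ n" for n r
    by (induction n) (simp_all add: r mis_count_disjoint_union_Cons mis_count_cycle_5)
  show ?thesis
    using assms by (auto simp: extremal_graphs_def mis_bound_def n mis_count_disjoint_union_Cons
        mis_count_star split: if_splits)
qed

lemma induced_copy_card:
  "induced_copy E W H \<Longrightarrow> card W = card (pverts H)"
  by (auto simp: induced_copy_def bij_betw_same_card)

text \<open>Each cycle contributes its 5 vertices and the edgeless part none, so this number depends
  on n alone.\<close>

lemma card_nonisolated_c5_union: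
  assumes "c5_union E n W"
  shows "finite W \<and> card {u\<in>W. \<exists>v\<in>W. (u, v) \<in> E} = 5 * n"
  using assms
proof (induction rule: c5_union.induct)
  case (edgeless I)
  then have "{u\<in>I. \<exists>v\<in>I. (u, v) \<in> E} = {}" by auto
  then show ?case using edgeless by (simp del: Collect_empty_eq)
next
  case (add_cycle n W D)
  obtain f where f: "f ` D = {0, 1, 2, 3, 4}" and
    arcs: "\<And>u v. u \<in> D \<Longrightarrow> v \<in> D \<Longrightarrow> (f u, f v) \<in> parcs (cycle_graph 5) \<longleftrightarrow> (u, v) \<in> E"
    using add_cycle.hyps by (auto simp: induced_copy_def bij_betw_def cycle_graph_5(1))
  have D: "card D = 5"
    using induced_copy_card[OF add_cycle.hyps(2)] by (simp add: cycle_graph_5)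
  have nb: "\<exists>v\<in>D. (u, v) \<in> E" if "u \<in> D" for u
  proof -
    have "f u \<in> {0, 1, 2, 3, 4}" using f that by blast
    then have "\<exists>j\<in>{0, 1, 2, 3, 4}. (f u, j) \<in> parcs (cycle_graph 5)"
      by (auto simp: cycle_graph_5)
    then have "\<exists>j\<in>f ` D. (f u, j) \<in> parcs (cycle_graph 5)" using f by simp
    then show ?thesis using arcs that by blast
  qed
  have "{u\<in>D \<union> W. \<exists>v\<in>D \<union> W. (u, v) \<in> E} = D \<union> {u\<in>W. \<exists>v\<in>W. (u, v) \<in> E}"
    using nb add_cycle.hyps unfolding separated_def by blast
  moreover have "card (D \<union> {u\<in>W. \<exists>v\<in>W. (u, v) \<in> E}) = 5 + 5 * n"
    using add_cycle D by (subst card_Un_disjoint) (auto simp: separated_def intro: card_ge_0_finite)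
  ultimately show ?case using add_cycle D by (auto intro: card_ge_0_finite)
qed

section \<open>The inductive steps: deleting a vertex, splitting off a 5-cycle\<close>

context simple_relation
begin

lemma separatedI:
  assumes "A \<inter> B = {}" "\<And>a b. a \<in> A \<Longrightarrow> b \<in> B \<Longrightarrow> (a, b) \<notin> E"
  shows "separated E A B"
  using assms E_sym unfolding separated_def by blast

definition mis_bounded :: "'a set \<Rightarrow> bool" where
  "mis_bounded V \<longleftrightarrow> num_mis V \<le> mis_bound (nu E V) \<and>
     (num_mis V = mis_bound (nu E V) \<longrightarrow> extremal E (nu E V) V)"

text \<open>If some vertex \<open>v\<close> lies in all maximum matchings, delete \<open>v\<close> or its closed neighbourhood.
  In the case of equality both remainders are unions of 5-cycles with equally many non-isolated
  vertices, so that the neighbours of \<open>v\<close> are isolated after the deletion of \<open>v\<close>.\<close>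

lemma mis_bounded_delete:
  assumes "finite V" "v \<in> V" "nu E (V - {v}) < nu E V"
    and "mis_bounded (V - {v})" "mis_bounded (V - cnbs v)"
  shows "mis_bounded V"
proof -
  define n where "n = nu E V - 1"
  have t: "nu E V = n + 1" and n1: "nu E (V - {v}) \<le> n" using assms by (auto simp: n_def)
  have "nu E (V - cnbs v) \<le> nu E (V - {v})" using assms by (intro nu_mono) auto
  then have n2: "nu E (V - cnbs v) \<le> n" using n1 by simp
  have le1: "num_mis (V - {v}) \<le> mis_bound n"
    using assms(4) mis_bound_mono[OF n1] by (auto simp: mis_bounded_def)
  have le2: "num_mis (V - cnbs v) \<le> mis_bound n"
    using assms(5) mis_bound_mono[OF n2] by (auto simp: mis_bounded_def)
  have le: "num_mis V \<le> num_mis (V - {v}) + num_mis (V - cnbs v)"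
    using assms by (intro num_mis_le_delete)
  show ?thesis
  proof (cases "even n")
    case False
    \<comment> \<open>Here the values are 2x and 5x, so 4x < 5x and equality cannot occur.\<close>
    then have "2 * mis_bound n < mis_bound (n + 1)" by (cases n rule: mis_bound_cases) auto
    then show ?thesis using le le1 le2 by (auto simp: mis_bounded_def t)
  next
    case True
    then have m: "2 * mis_bound n = mis_bound (n + 1)" by (cases n rule: mis_bound_cases) auto
    have "extremal E (n + 1) V" if "num_mis V = mis_bound (n + 1)"
    proof -
      have eq: "num_mis (V - {v}) = mis_bound n" "num_mis (V - cnbs v) = mis_bound n"
        using that m le le1 le2 by auto
      \<comment> \<open>Attaining the value for n forces \<open>nu E W = n\<close>; as n is even,
        the extremal structure of \<open>W\<close> contains no star.\<close>
      have ext: "c5_union E (n div 2) W"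
        if "mis_bounded W" "nu E W \<le> n" "num_mis W = mis_bound n" for W
      proof -
        have "mis_bound n \<le> mis_bound (nu E W)" using that by (simp add: mis_bounded_def)
        then have "nu E W = n"
          using that(2) mis_bound_strict_mono by (simp add: strict_mono_less_eq)
        then show ?thesis using that True by (simp add: mis_bounded_def extremal_def)
      qed
      have c: "c5_union E (n div 2) (V - {v})" "c5_union E (n div 2) (V - cnbs v)"
        using ext assms n1 n2 eq by blast+
      define I where "I W = {u\<in>W. \<exists>w\<in>W. (u, w) \<in> E}" for W
      have "I (V - cnbs v) = I (V - {v})"
      proof (rule card_subset_eq)
        show "card (I (V - cnbs v)) = card (I (V - {v}))"
          using c[THEN card_nonisolated_c5_union] by (simp add: I_def)
      qed (use assms in \<open>auto simp: I_def\<close>)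
      \<comment> \<open>A neighbour \<open>u\<close> of \<open>v\<close> is absent from
        \<open>V - cnbs v\<close>, so it is not among the common non-isolated vertices.\<close>
      then have iso: "(u, w) \<notin> E" if "u \<in> nbs v" "w \<in> V - {v}" "u \<in> V" for u w
        using that E_irrefl unfolding I_def by blast
      let ?L = "V \<inter> nbs v"
      \<comment> \<open>Without neighbours \<open>v\<close> would be missed by every matching,
        against the drop of \<open>nu\<close>. This provides the leaf that the star
        requires.\<close>
      have "?L \<noteq> {}"
      proof
        assume "?L = {}"
        obtain X where X: "X \<subseteq> V" "pm X" "card X = 2 * nu E V" using nu_witness assms by metis
        have "v \<notin> X" using X \<open>?L = {}\<close> pm_partner[of X v] by blast
        then have "card X \<le> 2 * nu E (V - {v})" using X assms by (intro card_le_nu) auto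
        then show False using X assms by simp
      qed
      moreover have "finite ?L" using assms by simp
      ultimately have L: "card ?L \<ge> 1" by (simp add: Suc_le_eq card_gt_0_iff)
      obtain g where g: "bij_betw g ?L {1..card ?L}"
        using ex_bij_betw_nat_finite_1[OF \<open>finite ?L\<close>] bij_betw_inv by blast
      have "induced_copy E (insert v ?L) (star_graph (card ?L))"
        unfolding induced_copy_def
      proof (intro exI conjI ballI)
        let ?f = "\<lambda>x. if x = v then 0 else g x"
        have "v \<notin> ?L" using E_irrefl by auto
        have gL: "g x \<in> {1..card ?L}" if "x \<in> ?L" for x using g that by (auto simp: bij_betw_def)
        have "bij_betw ?f ?L {1..card ?L}"
          by (rule bij_betw_cong[THEN iffD1, OF _ g]) (use \<open>v \<notin> ?L\<close> in auto)
        moreover have "bij_betw ?f {v} {0}" by (auto simp: bij_betw_def)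
        ultimately have "bij_betw ?f ({v} \<union> ?L) ({0} \<union> {1..card ?L})"
          by (intro bij_betw_combine) auto
        moreover have "{0} \<union> {1..card ?L} = {..card ?L}" by auto
        ultimately show "bij_betw ?f (insert v ?L) (pverts (star_graph (card ?L)))"
          by (simp add: star_graph_def)
        fix x y assume "x \<in> insert v ?L" "y \<in> insert v ?L"
        then consider "x = v" "y = v" | "x = v" "y \<in> ?L" | "x \<in> ?L" "y = v" | "x \<in> ?L" "y \<in> ?L"
          by blast
        then show "(?f x, ?f y) \<in> parcs (star_graph (card ?L)) \<longleftrightarrow> (x, y) \<in> E"
        proof cases
          case 1
          then show ?thesis using E_irrefl by (simp add: star_graph_def)
        next
          case 2
          then show ?thesis using \<open>v \<notin> ?L\<close> gL[of y] by (auto simp: star_graph_def)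
        next
          case 3
          then show ?thesis using \<open>v \<notin> ?L\<close> gL[of x] E_sym by (auto simp: star_graph_def)
        next
          case 4
          then have "(x, y) \<notin> E" using iso \<open>v \<notin> ?L\<close> by blast
          then show ?thesis using 4 \<open>v \<notin> ?L\<close> gL[of x] gL[of y] by (auto simp: star_graph_def)
        qed
      qed
      moreover have "separated E (insert v ?L) (V - cnbs v)"
        using iso E_irrefl by (intro separatedI) auto
      moreover have "V = insert v ?L \<union> (V - cnbs v)" using assms by auto
      ultimately have "\<exists>S W l. V = S \<union> W \<and> separated E S W \<and> l \<ge> 1 \<and>
          induced_copy E S (star_graph l) \<and> c5_union E (n div 2) W"
        using L c(2) by blast
      then show ?thesis using True by (simp add: extremal_def)
    qed
    then show ?thesis using le le1 le2 m by (auto simp: mis_bounded_def t)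
  qed
qed

lemma extremal_add_cycle:
  assumes "extremal E t W" "induced_copy E D (cycle_graph 5)" "separated E D W"
  shows "extremal E (t + 2) (D \<union> W)"
proof (cases "even t")
  case True
  then show ?thesis using assms c5_union.add_cycle[of E "t div 2" W D] by (simp add: extremal_def)
next
  case False
  then obtain S U l where U: "W = S \<union> U" "separated E S U" "l \<ge> 1"
    "induced_copy E S (star_graph l)" "c5_union E ((t - 1) div 2) U"
    using assms by (auto simp: extremal_def)
  have "separated E D U" using U assms by (auto simp: separated_def)
  then have "c5_union E (Suc ((t - 1) div 2)) (D \<union> U)"
    using U assms by (intro c5_union.add_cycle)
  moreover have "Suc ((t - 1) div 2) = (t + 2 - 1) div 2" using False by (auto elim: oddE)
  moreover have "separated E S (D \<union> U)" using U assms by (auto simp: separated_def)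
  moreover have "D \<union> W = S \<union> (D \<union> U)" using U by auto
  ultimately show ?thesis using False U unfolding extremal_def by (auto simp del: One_nat_def)
qed

text \<open>Two disjoint edges of the cycle, leaving one of its vertices uncovered, extend a maximum
  matching of \<open>W\<close>.\<close>

lemma nu_add_cycle:
  assumes "finite W" "induced_copy E D (cycle_graph 5)" "separated E D W"
  shows "nu E W + 2 \<le> nu E (D \<union> W)"
proof -
  have D: "finite D"
    using induced_copy_card[OF assms(2)] by (auto simp: cycle_graph_5 intro: card_ge_0_finite)
  obtain f where f: "inj_on f D" "f ` D = {0, 1, 2, 3, 4}" and
    arcs: "\<And>u v. u \<in> D \<Longrightarrow> v \<in> D \<Longrightarrow> (f u, f v) \<in> parcs (cycle_graph 5) \<longleftrightarrow> (u, v) \<in> E"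
    using assms by (auto simp: induced_copy_def bij_betw_def cycle_graph_5(1))
  have "\<exists>x\<in>D. f x = i" if "i \<in> {0, 1, 2, 3}" for i
  proof -
    have "i \<in> f ` D" using that unfolding f(2) by blast
    then show ?thesis by blast
  qed
  from this[of 0] this[of 1] this[of 2] this[of 3]
  obtain a b c d where abcd: "a \<in> D" "b \<in> D" "c \<in> D" "d \<in> D"
    and v: "f a = 0" "f b = 1" "f c = 2" "f d = 3" by auto
  have "(a, b) \<in> E" "(c, d) \<in> E"
    using arcs[of a b] arcs[of c d] abcd v by (auto simp: cycle_graph_5)
  moreover have "a \<noteq> b" "a \<noteq> c" "a \<noteq> d" "b \<noteq> c" "b \<noteq> d" "c \<noteq> d" using v by auto
  ultimately have p: "pm ({a, b} \<union> {c, d})" "card ({a, b} \<union> {c, d}) = 4"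
    using perfectly_matchable_Un[OF pm_edge pm_edge, of a b c d] by simp_all
  obtain X where X: "X \<subseteq> W" "pm X" "card X = 2 * nu E W" using nu_witness assms by metis
  have disj: "({a, b} \<union> {c, d}) \<inter> X = {}" using X abcd assms by (auto simp: separated_def)
  have "pm (({a, b} \<union> {c, d}) \<union> X)" by (rule perfectly_matchable_Un[OF p(1) X(2) disj])
  then have "card (({a, b} \<union> {c, d}) \<union> X) \<le> 2 * nu E (D \<union> W)"
    using X abcd assms D by (intro card_le_nu) auto
  moreover have "card (({a, b} \<union> {c, d}) \<union> X) = 4 + 2 * nu E W"
    using disj p X perfectly_matchable_finite by (subst card_Un_disjoint) auto
  ultimately show ?thesis by simp
qed

lemma mis_bounded_add_cycle:
  assumes "finite W" "induced_copy E D (cycle_graph 5)" "separated E D W" "mis_bounded W"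
  shows "mis_bounded (D \<union> W)"
proof -
  have eq: "num_mis (D \<union> W) = 5 * num_mis W"
    using assms by (simp add: card_mis_sets_Un card_mis_sets_induced_copy mis_count_cycle_5)
  \<comment> \<open>Only this inequality is available at first; in the equality case strict
    monotonicity of \<open>mis_bound\<close> turns it into \<open>nu E W = n\<close>.\<close>
  obtain n where n: "nu E (D \<union> W) = n + 2" "nu E W \<le> n"
    using nu_add_cycle[OF assms(1-3)] by (metis add_le_cancel_right le_add2 le_add_diff_inverse2 le_trans)
  have m: "mis_bound (n + 2) = 5 * mis_bound n" by (cases n rule: mis_bound_cases) auto
  have le: "num_mis W \<le> mis_bound (nu E W)" "mis_bound (nu E W) \<le> mis_bound n"
    using assms n mis_bound_mono by (auto simp: mis_bounded_def)
  have "extremal E (n + 2) (D \<union> W)" if "num_mis W = mis_bound n"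
  proof -
    have "mis_bound (nu E W) = mis_bound n" using that le by simp
    then have "nu E W = n" using mis_bound_strict_mono by (simp add: strict_mono_eq)
    then have "extremal E n W" using that assms by (simp add: mis_bounded_def)
    then show ?thesis using assms by (intro extremal_add_cycle)
  qed
  then show ?thesis using le m n eq by (auto simp: mis_bounded_def)
qed

end

section \<open>Factor-critical components without triangles, and the induction\<close>

locale triangle_free_relation = simple_relation +
  assumes E_triangle_free: "(u, v) \<in> E \<Longrightarrow> (v, w) \<in> E \<Longrightarrow> (u, w) \<notin> E"
begin

text \<open>Any chord of a 5-cycle cuts off a triangle, so every 5-cycle is induced.\<close>

lemma induced_copy_cycle_5:
  assumes "distinct [a, b, c, d, e]"
    and "(a, b) \<in> E" "(b, c) \<in> E" "(c, d) \<in> E" "(d, e) \<in> E" "(e, a) \<in> E"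
  shows "induced_copy E {a, b, c, d, e} (cycle_graph 5)"
proof -
  have arcs: "(b, a) \<in> E" "(c, b) \<in> E" "(d, c) \<in> E" "(e, d) \<in> E" "(a, e) \<in> E"
    using assms E_sym by auto
  have chords: "(a, c) \<notin> E" "(a, d) \<notin> E" "(b, d) \<notin> E" "(b, e) \<notin> E" "(c, e) \<notin> E"
    "(c, a) \<notin> E" "(d, a) \<notin> E" "(d, b) \<notin> E" "(e, b) \<notin> E" "(e, c) \<notin> E"
    using assms arcs E_triangle_free by blast+
  define f :: "'a \<Rightarrow> nat" where
    "f x = (if x = a then 0 else if x = b then 1 else if x = c then 2 else if x = d then 3 else 4)" for x
  have f: "f a = 0" "f b = 1" "f c = 2" "f d = 3" "f e = 4"
    using assms(1) by (auto simp: f_def)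
  have img: "f ` {a, b, c, d, e} = pverts (cycle_graph 5)" by (simp add: cycle_graph_5 f)
  moreover have "inj_on f {a, b, c, d, e}"
    by (rule eq_card_imp_inj_on) (use assms(1) in \<open>simp_all add: img cycle_graph_5 del: image_insert\<close>)
  ultimately have "bij_betw f {a, b, c, d, e} (pverts (cycle_graph 5))"
    by (simp add: bij_betw_def)
  moreover have "(f x, f y) \<in> parcs (cycle_graph 5) \<longleftrightarrow> (x, y) \<in> E"
    if "x \<in> {a, b, c, d, e}" "y \<in> {a, b, c, d, e}" for x y
    using that
    by (elim insertE emptyE; simp add: f cycle_graph_5 assms(2-) arcs chords E_irrefl)
  ultimately show ?thesis unfolding induced_copy_def by blast
qed

text \<open>If some \<open>v\<close> has three neighbours in \<open>C\<close>, branch on \<open>v\<close> and then on a vertex \<open>w\<close> at distance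
  two. Otherwise \<open>C\<close> is 2-regular without 5-cycles; branch over the closed neighbourhood of \<open>r\<close>,
  and then from the first vertex of a path left over.\<close>

lemma num_mis_component:
  assumes V: "finite V" and CV: "C \<subseteq> V"
    and closed: "\<And>u v. u \<in> C \<Longrightarrow> v \<in> V \<Longrightarrow> (u, v) \<in> E \<Longrightarrow> v \<in> C"
    and card_C: "card C = 2 * k + 1" and crit: "\<And>u. u \<in> C \<Longrightarrow> pm (C - {u})"
    and rest: "nu E (V - C) + k \<le> nu E V"
    and edge: "r \<in> C" "s \<in> V" "(r, s) \<in> E"
    and smaller: "\<And>W. W \<subset> V \<Longrightarrow> num_mis W \<le> mis_bound (nu E W)"
    and no_cycle: "\<And>D. D \<subseteq> C \<Longrightarrow> induced_copy E D (cycle_graph 5) \<Longrightarrow> \<not> separated E D (V - D)"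
  shows "num_mis V < mis_bound (nu E V)"
proof -
  define nb where "nb u = C \<inter> nbs u" for u
  have fin: "finite C" "finite (nb u)" for u using V CV finite_subset by (auto simp: nb_def)
  have nb_iff: "v \<in> nb u \<longleftrightarrow> v \<in> V \<and> (u, v) \<in> E" if "u \<in> C" for u v
    using that closed CV by (auto simp: nb_def)
  have nb_sym: "v \<in> nb u \<Longrightarrow> u \<in> C \<Longrightarrow> u \<in> nb v" for u v
    using E_sym by (auto simp: nb_def)
  have nb_C: "v \<in> nb u \<Longrightarrow> v \<in> C" for u v by (simp add: nb_def)
  have nb_irrefl: "u \<notin> nb u" for u using E_irrefl by (simp add: nb_def)
  have nb_tri: "v \<in> nb u \<Longrightarrow> w \<in> nb v \<Longrightarrow> w \<notin> nb u" for u v w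
    using E_triangle_free by (auto simp: nb_def)
  let ?q = "nu E (V - C)"
  \<comment> \<open>\<open>Y\<close> collects deleted vertices of \<open>C\<close> that are known by
    name: what is left of \<open>C\<close> is bounded by half its size, the rest by
    \<open>?q\<close>.\<close>
  have bound: "num_mis (V - X) \<le> mis_bound ((2 * k + 1 - card Y) div 2 + ?q)"
    if "Y \<subseteq> C" "Y \<subseteq> X" "Y \<noteq> {}" for X Y
  proof -
    have "V - X \<subset> V" using that CV by blast
    then have "num_mis (V - X) \<le> mis_bound (nu E (V - X))" by (rule smaller)
    also have "\<dots> \<le> mis_bound (card ((V - X) \<inter> C) div 2 + ?q)"
      using nu_le_component[where W = "V - X", OF V CV closed] by (intro mis_bound_mono) auto
    also have "card ((V - X) \<inter> C) \<le> card (C - Y)" using that fin by (intro card_mono) auto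
    then have "mis_bound (card ((V - X) \<inter> C) div 2 + ?q) \<le> mis_bound (card (C - Y) div 2 + ?q)"
      by (intro mis_bound_mono add_right_mono div_le_mono)
    also have "card (C - Y) = 2 * k + 1 - card Y"
      using that fin card_C by (simp add: card_Diff_subset finite_subset)
    finally show ?thesis .
  qed
  \<comment> \<open>In a perfect matching of \<open>C - {w}\<close> the partner of \<open>u\<close>
    is a neighbour other than \<open>w\<close>.\<close>
  have deg2: "\<exists>v\<in>nb u. v \<noteq> w" if u: "u \<in> C" "u \<noteq> w" "w \<in> C" for u w
  proof -
    obtain v where "v \<in> C - {w}" "(u, v) \<in> E" using pm_partner[OF crit, of w u] u by blast
    then show ?thesis by (auto simp: nb_def)
  qed
  \<comment> \<open>The edge from \<open>r\<close> to \<open>s\<close> excludes that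
    \<open>C\<close> is a single vertex.\<close>
  have "s \<in> C" using closed edge by blast
  moreover have "r \<noteq> s" using edge E_irrefl by auto
  ultimately have "\<exists>w\<in>C. u \<noteq> w" for u using edge(1) by (cases "u = r") auto
  then have nonempty: "nb u \<noteq> {}" if "u \<in> C" for u using deg2 that by blast
  have other: "\<exists>v\<in>nb u. v \<noteq> w" if "u \<in> C" for u w
  proof (cases "w \<in> C \<and> u \<noteq> w")
    case False
    then have "w \<notin> nb u" using nb_irrefl nb_C by blast
    then show ?thesis using nonempty[OF that] by (metis ex_in_conv)
  qed (use deg2 that in blast)
  have card_ge2: "2 \<le> card (nb u)" if u: "u \<in> C" for u
  proof -
    obtain v where v: "v \<in> nb u" using nonempty[OF u] by blast
    obtain w where "w \<in> nb u" "w \<noteq> v" using other[OF u] by blast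
    then have "card {v, w} \<le> card (nb u)" using v fin by (intro card_mono) auto
    then show ?thesis using \<open>w \<noteq> v\<close> by simp
  qed
  show ?thesis
  proof (cases "\<exists>v\<in>C. 3 \<le> card (nb v)")
    case True
    then obtain v where v: "v \<in> C" "3 \<le> card (nb v)" by blast
    obtain x where x: "x \<in> nb v" using nonempty[OF v(1)] by blast
    obtain w where w: "w \<in> nb x" "w \<noteq> v" using other nb_C[OF x] by blast
    have wC: "w \<in> C" "w \<notin> nb v" using nb_C[OF w(1)] nb_tri[OF x w(1)] by auto
    have vw: "v \<notin> nb w" using wC nb_sym by blast
    have card_v: "4 \<le> card (insert v (nb v))" using v fin nb_irrefl by simp
    have card_w: "4 \<le> card (insert v (insert w (nb w)))"
      using card_ge2[OF wC(1)] fin nb_irrefl vw w by simp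
    have "card (insert v (nb v)) \<le> card C" using v fin nb_C by (intro card_mono) auto
    then have "k = (k - 2) + 2" using card_v card_C by linarith
    then obtain j where j: "k = j + 2" by blast
    \<comment> \<open>Of the 2j + 5 vertices of \<open>C\<close> this branch deletes two, leaving
      room for j + 1 edges. The other two branches delete at least four each, leaving room for
      j.\<close>
    have "num_mis (V - {v} - {w}) \<le> mis_bound ((j + ?q) + 1)"
      using bound[of "{v, w}" "{v, w}"] v wC w j
      by (simp add: Diff_insert2[symmetric] insert_commute)
    moreover have "num_mis (V - {v} - cnbs w) \<le> mis_bound (j + ?q)"
    proof -
      have "num_mis (V - insert v (cnbs w)) \<le>
          mis_bound ((2 * k + 1 - card (insert v (insert w (nb w)))) div 2 + ?q)"
        using v wC nb_C by (intro bound) (auto simp: nb_def)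
      also have "\<dots> \<le> mis_bound (j + ?q)"
        using card_w j by (intro mis_bound_mono) auto
      finally show ?thesis by (simp add: Diff_insert2[symmetric])
    qed
    moreover have "num_mis (V - cnbs v) \<le> mis_bound (j + ?q)"
    proof -
      have "num_mis (V - cnbs v) \<le> mis_bound ((2 * k + 1 - card (insert v (nb v))) div 2 + ?q)"
        using v nb_C by (intro bound) (auto simp: nb_def)
      also have "\<dots> \<le> mis_bound (j + ?q)"
        using card_v j by (intro mis_bound_mono) auto
      finally show ?thesis .
    qed
    moreover have "num_mis V \<le> num_mis (V - {v}) + num_mis (V - cnbs v)"
      using V v CV by (intro num_mis_le_delete) auto
    moreover have "num_mis (V - {v}) \<le> num_mis (V - {v} - {w}) + num_mis (V - {v} - cnbs w)"
      using V wC w CV by (intro num_mis_le_delete) auto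
    \<comment> \<open>The two parities give 4x < 5x and 9x < 10x.\<close>
    moreover have "mis_bound (j + ?q + 1) + 2 * mis_bound (j + ?q) < mis_bound (j + ?q + 2)"
      by (cases "j + ?q" rule: mis_bound_cases) auto
    moreover have "mis_bound (j + ?q + 2) \<le> mis_bound (nu E V)"
      using rest j by (intro mis_bound_mono) auto
    ultimately show ?thesis by linarith
  next
    case False
    then have card_2: "card (nb u) = 2" if "u \<in> C" for u
      using card_ge2[OF that] that by fastforce
    have nb2: "nb u = {v, w}" if "u \<in> C" "v \<in> nb u" "w \<in> nb u" "v \<noteq> w" for u v w
    proof (rule sym, rule card_subset_eq)
      show "card {v, w} = card (nb u)" using that card_2 by simp
    qed (use that fin in auto)
    \<comment> \<open>Truncated subtraction; \<open>local_bound\<close> also proves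
      \<open>k \<ge> 3\<close> so that j + 3 = k is available later.\<close>
    define j where "j = k - 3"
    have local_bound: "k \<ge> 3 \<and>
      num_mis (V - cnbs u) \<le> mis_bound (j + ?q + 1) + mis_bound (j + ?q)" if u: "u \<in> C" for u
    proof -
      obtain x where x: "x \<in> nb u" using nonempty[OF u] by blast
      obtain y where y: "y \<in> nb u" "y \<noteq> x" using other[OF u] by blast
      have xy: "x \<in> C" "y \<in> C" using x y nb_C by auto
      have ux: "u \<in> nb x" "u \<in> nb y" using nb_sym[OF x u] nb_sym[OF y(1) u] by auto
      obtain p where p: "p \<in> nb x" "p \<noteq> u" using other[OF xy(1)] by blast
      obtain q where q: "q \<in> nb y" "q \<noteq> u" using other[OF xy(2)] by blast
      have pq: "p \<in> C" "q \<in> C" using p q nb_C by auto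
      have xp: "x \<in> nb p" "y \<in> nb q" using nb_sym[OF p(1) xy(1)] nb_sym[OF q(1) xy(2)] by auto
      have nbu: "nb u = {x, y}" and nbx: "nb x = {u, p}" and nby: "nb y = {u, q}"
        using nb2[OF u x y(1)] nb2[OF xy(1) ux(1) p(1)] nb2[OF xy(2) ux(2) q(1)] y p q by auto
      have p_not: "p \<notin> nb u" "q \<notin> nb u" using nb_tri x y p q by blast+
      have ne: "u \<noteq> x" "u \<noteq> y" "x \<noteq> p" "y \<noteq> q" "p \<noteq> y" "q \<noteq> x"
        using nb_irrefl x y p q p_not by auto
      have "p \<noteq> q"
      proof
        assume "p = q"
        \<comment> \<open>On a 4-cycle, \<open>x\<close> and \<open>y\<close> would both have
          \<open>p\<close> as their only neighbour after the deletion of \<open>u\<close>, so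
          \<open>C - {u}\<close> could not be perfectly matched.\<close>
        have "\<exists>z\<in>C - {u}. (x, z) \<in> E \<and> x \<noteq> z \<and> pm (C - {u} - {x, z})"
          using pm_partner[OF crit[OF u]] xy ne by auto
        then obtain z where z: "z \<in> C - {u}" "(x, z) \<in> E" "pm (C - {u} - {x, z})" by blast
        then have "z = p" using nbx by (auto simp: nb_def)
        then have "\<exists>z'\<in>C - {u} - {x, z}. (y, z') \<in> E"
          using pm_partner[OF z(3), of y] xy ne y by auto
        then show False using nby \<open>p = q\<close> \<open>z = p\<close> by (auto simp: nb_def)
      qed
      obtain e where e: "e \<in> nb p" "e \<noteq> x" using other[OF pq(1)] by blast
      have eC: "e \<in> C" "p \<in> nb e" using nb_C[OF e(1)] nb_sym[OF e(1) pq(1)] by auto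
      have nbp: "nb p = {x, e}" using nb2[OF pq(1) xp(1) e(1)] e by auto
      have e_ne: "e \<noteq> u" "e \<noteq> y" "e \<noteq> p" "p \<noteq> u"
        using eC(2) nbu nby ne nb_irrefl p \<open>p \<noteq> q\<close> by auto
      \<comment> \<open>Otherwise u, x, p, q, y form a 5-cycle; all degrees being 2, no edge leaves
        it, which \<open>no_cycle\<close> forbids.\<close>
      have "e \<noteq> q"
      proof
        assume "e = q"
        then have nbq: "nb q = {y, p}" using nb2[OF pq(2) xp(2), of p] eC ne by auto
        let ?D = "{u, x, p, q, y}"
        have "induced_copy E ?D (cycle_graph 5)"
          using x p e \<open>e = q\<close> xp ux ne y \<open>p \<noteq> q\<close> e_ne q
          by (intro induced_copy_cycle_5) (auto simp: nb_def)
        moreover have "separated E ?D (V - ?D)"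
        proof (rule separatedI)
          fix a b assume ab: "a \<in> ?D" "b \<in> V - ?D"
          then have "b \<notin> nb a" using nbu nbx nby nbp nbq \<open>e = q\<close> by auto
          then show "(a, b) \<notin> E" using ab nb_iff[of a b] u xy pq by auto
        qed auto
        moreover have "?D \<subseteq> C" using u xy pq by auto
        ultimately show False using no_cycle by blast
      qed
      obtain g where g: "g \<in> nb e" "g \<noteq> p" using other[OF eC(1)] by blast
      have gC: "g \<in> C" "e \<in> nb g" using nb_C[OF g(1)] nb_sym[OF g(1) eC(1)] by auto
      have g_ne: "g \<noteq> u" "g \<noteq> x" "g \<noteq> y" "g \<noteq> e"
        using gC(2) nbu nbx nby e e_ne ne nb_irrefl \<open>e \<noteq> q\<close> by auto
      have "card {u, x, y, p, q, e} = 6"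
        using ne y p q \<open>p \<noteq> q\<close> e e_ne \<open>e \<noteq> q\<close> by auto
      moreover have "card {u, x, y, p, q, e} \<le> card C"
        using u xy pq eC fin by (intro card_mono) auto
      \<comment> \<open>Six vertices are known and the size of \<open>C\<close> is odd, so it is at
        least 7.\<close>
      ultimately have k: "k \<ge> 3" using card_C by linarith
      let ?W = "V - cnbs u"
      have pW: "p \<in> ?W" using p_not pq CV e_ne by (auto simp: nb_def)
      \<comment> \<open>Deleting \<open>u\<close> and its neighbours makes \<open>p\<close> the end
        of a path, so only \<open>p\<close> and \<open>e\<close> remain as branches. Together with
        u, x, y they delete at least 5 and 6 vertices, respectively.\<close>
      have "?W \<inter> cnbs p = {p, e}"
      proof -
        have eW: "e \<in> ?W" using nbu e_ne e eC CV by (auto simp: nb_def)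
        have nbW: "z = e" if "z \<in> ?W" "(p, z) \<in> E" for z
        proof -
          have "z \<in> {x, e}" using nb_iff[OF pq(1), of z] nbp that by blast
          moreover have "(u, x) \<in> E" using x by (simp add: nb_def)
          ultimately show ?thesis using that(1) by blast
        qed
        have "?W \<inter> nbs p = {e}"
        proof
          show "?W \<inter> nbs p \<subseteq> {e}" using nbW by blast
          show "{e} \<subseteq> ?W \<inter> nbs p" using eW e by (simp add: nb_def)
        qed
        then show ?thesis using pW by (simp add: Int_insert_right)
      qed
      then have "num_mis ?W \<le> num_mis (?W - cnbs p) + num_mis (?W - cnbs e)"
        using num_mis_le_nbs[of ?W p] pW V e_ne by simp
      moreover have "num_mis (?W - cnbs p) \<le> mis_bound (j + ?q + 1)"
      proof -
        have "num_mis (V - (cnbs u \<union> cnbs p)) \<le>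
            mis_bound ((2 * k + 1 - card {u, x, y, p, e}) div 2 + ?q)"
          using u xy pq eC x y e by (intro bound) (auto simp: nb_def)
        also have "(2 * k + 1 - card {u, x, y, p, e}) div 2 + ?q = j + ?q + 1"
          using k ne y e e_ne by (simp add: j_def)
        also have "V - (cnbs u \<union> cnbs p) = ?W - cnbs p" by blast
        finally show ?thesis .
      qed
      moreover have "num_mis (?W - cnbs e) \<le> mis_bound (j + ?q)"
      proof -
        \<comment> \<open>The vertices counted are u, x, y and the closed neighbourhood of
          \<open>e\<close>; \<open>q\<close> is left out because it may coincide with
          \<open>g\<close>.\<close>
        have "num_mis (V - (cnbs u \<union> cnbs e)) \<le>
            mis_bound ((2 * k + 1 - card {u, x, y, p, e, g}) div 2 + ?q)"
          using u xy pq eC x y g gC by (intro bound) (auto simp: nb_def)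
        also have "(2 * k + 1 - card {u, x, y, p, e, g}) div 2 + ?q = j + ?q"
          using k ne y e e_ne g g_ne by (simp add: j_def)
        also have "V - (cnbs u \<union> cnbs e) = ?W - cnbs e" by blast
        finally show ?thesis .
      qed
      ultimately show ?thesis using k by linarith
    qed
    let ?b = "mis_bound (j + ?q + 1) + mis_bound (j + ?q)"
    have "V \<inter> cnbs r = insert r (nb r)" using nb_iff[OF edge(1)] edge CV by auto
    then have "num_mis V \<le> (\<Sum>u\<in>insert r (nb r). num_mis (V - cnbs u))"
      using num_mis_le_nbs[OF V, of r] edge CV by auto
    also have "\<dots> \<le> of_nat (card (insert r (nb r))) * ?b"
      using local_bound edge nb_C by (intro sum_bounded_above) auto
    also have "\<dots> = 3 * ?b" using card_2[OF edge(1)] nb_irrefl fin by simp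
    \<comment> \<open>The factor 3 counts \<open>r\<close> and its two neighbours; the two parities
      give 9x < 10x and 21x < 25x.\<close>
    also have "\<dots> < mis_bound (j + ?q + 3)"
      by (cases "j + ?q" rule: mis_bound_cases) auto
    also have "\<dots> \<le> mis_bound (nu E V)"
      using rest local_bound[OF edge(1)] by (intro mis_bound_mono) (simp add: j_def)
    finally show ?thesis .
  qed
qed

lemma mis_bounded:
  assumes "finite V"
  shows "mis_bounded V"
  using assms
proof (induction V rule: finite_psubset_induct)
  case (psubset V)
  consider v where "v \<in> V" "nu E (V - {v}) < nu E V"
    | "\<And>u v. u \<in> V \<Longrightarrow> v \<in> V \<Longrightarrow> (u, v) \<notin> E"
    | r s where "r \<in> V" "s \<in> V" "(r, s) \<in> E" "\<And>v. v \<in> V \<Longrightarrow> nu E (V - {v}) = nu E V"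
  proof -
    have "nu E (V - {v}) \<le> nu E V" for v using psubset.hyps by (intro nu_mono) auto
    then have "nu E (V - {v}) = nu E V" if "\<not> nu E (V - {v}) < nu E V" for v
      using that by (meson le_antisym not_le)
    then show thesis using that by blast
  qed
  then show ?case
  proof cases
    case (1 v)
    then have "V - {v} \<subset> V" "V - cnbs v \<subset> V" by blast+
    then show ?thesis using mis_bounded_delete[OF psubset.hyps 1] psubset.IH by blast
  next
    case 2
    obtain X where X: "X \<subseteq> V" "pm X" "card X = 2 * nu E V" using nu_witness psubset.hyps by metis
    have "X = {}" using X 2 pm_partner[OF X(2)] by blast
    then have "nu E V = 0" using X by simp
    then show ?thesis using 2 psubset.hyps
      by (simp add: mis_bounded_def mis_sets_edgeless mis_bound_def extremal_def c5_union.edgeless)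
  next
    case (3 r s)
    obtain C k where C: "r \<in> C" "C \<subseteq> V"
      "\<And>u v. u \<in> C \<Longrightarrow> v \<in> V \<Longrightarrow> (u, v) \<in> E \<Longrightarrow> v \<in> C"
      "card C = 2 * k + 1" "\<And>u. u \<in> C \<Longrightarrow> pm (C - {u})" "nu E (V - C) + k \<le> nu E V"
      using gallai_component[OF psubset.hyps 3(4,1)] by blast
    show ?thesis
    \<comment> \<open>A separated 5-cycle is the only situation here in which equality is possible;
      it is split off, and its factor 5 matches the growth of the bound.\<close>
    proof (cases "\<exists>D\<subseteq>C. induced_copy E D (cycle_graph 5) \<and> separated E D (V - D)")
      case True
      then obtain D where D: "D \<subseteq> C" "induced_copy E D (cycle_graph 5)" "separated E D (V - D)"
        by blast
      have "D \<noteq> {}" using induced_copy_card[OF D(2)] by (auto simp: cycle_graph_5)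
      then have "V - D \<subset> V" using D(1) C(2) by blast
      then have "mis_bounded (V - D)" by (rule psubset.IH)
      then have "mis_bounded (D \<union> (V - D))"
        using D psubset.hyps by (intro mis_bounded_add_cycle) auto
      moreover have "D \<union> (V - D) = V" using D C by auto
      ultimately show ?thesis by simp
    next
      case False
      have "num_mis V < mis_bound (nu E V)"
      proof (rule num_mis_component[OF psubset.hyps C(2-6) C(1) 3(2,3)])
        show "num_mis W \<le> mis_bound (nu E W)" if "W \<subset> V" for W
          using psubset.IH[OF that] by (simp add: mis_bounded_def)
        show "\<not> separated E D (V - D)" if "D \<subseteq> C" "induced_copy E D (cycle_graph 5)" for D
          using False that by blast
      qed
      then show ?thesis by (simp add: mis_bounded_def)
    qed
  qed
qed

end

section \<open>Graphs\<close>

lemma pair_graph_simple_relation: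
  assumes "pair_graph G"
  shows "simple_relation (parcs G)"
proof -
  interpret pair_graph G by fact
  show ?thesis
  proof
    show "(v, u) \<in> parcs G" if "(u, v) \<in> parcs G" for u v
      using that pair_sym_arcs by (simp add: symmetric_def symD)
    show "(u, u) \<notin> parcs G" for u using pair_no_loops by fastforce
  qed
qed

text \<open>An undominated vertex outside an independent set could be added to it, so maximality
  under inclusion amounts to domination.\<close>

lemma mis_eq_card_mis_sets:
  assumes "pair_graph G"
  shows "mis G = card (mis_sets (parcs G) (pverts G))"
proof -
  interpret simple_relation "parcs G" using assms by (rule pair_graph_simple_relation)
  have "maximal_independent_set G S \<longleftrightarrow> S \<in> mis_sets (parcs G) (pverts G)" for S
  proof
    assume S: "maximal_independent_set G S"
    then have ind: "independent_set G S" by (simp add: maximal_independent_set_def)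
    have "\<exists>y\<in>S. (x, y) \<in> parcs G" if x: "x \<in> pverts G - S" for x
    proof (rule ccontr)
      assume "\<not> ?thesis"
      then have "independent_set G (insert x S)"
        using ind x E_sym E_irrefl unfolding independent_set_def by blast
      then have "insert x S = S" using S by (auto simp: maximal_independent_set_def)
      then show False using x by auto
    qed
    then show "S \<in> mis_sets (parcs G) (pverts G)"
      using ind by (simp add: independent_set_def mis_sets_def)
  next
    assume S: "S \<in> mis_sets (parcs G) (pverts G)"
    then have "independent_set G S" by (simp add: independent_set_def mis_sets_def)
    moreover have "T = S" if T: "independent_set G T" "S \<subseteq> T" for T
    proof (rule ccontr)
      assume "T \<noteq> S"
      then obtain x where x: "x \<in> T" "x \<notin> S" using T by blast
      then have "x \<in> pverts G - S" using T by (auto simp: independent_set_def)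
      then obtain y where "y \<in> S" "(x, y) \<in> parcs G" using S unfolding mis_sets_def by blast
      then show False using T x by (auto simp: independent_set_def)
    qed
    ultimately show "maximal_independent_set G S" by (simp add: maximal_independent_set_def)
  qed
  then show ?thesis by (simp add: mis_def)
qed

section \<open>Matchings as edge sets and as sets of covered vertices\<close>

context simple_relation
begin

lemma pm_Union_matching:
  assumes "finite M" "M \<subseteq> {{u, v} | u v. (u, v) \<in> E}" "disjoint M"
  shows "pm (\<Union> M) \<and> card (\<Union> M) = 2 * card M"
  using assms
proof (induction M rule: finite_induct)
  case (insert F M)
  then have IH: "pm (\<Union> M)" "card (\<Union> M) = 2 * card M"
    by (auto simp: pairwise_insert)
  obtain u v where F: "F = {u, v}" "(u, v) \<in> E" using insert by auto
  have disj: "F \<inter> \<Union> M = {}" using insert by (auto simp: disjoint_def)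
  have "pm (F \<union> \<Union> M)" using perfectly_matchable_Un[OF pm_edge IH(1)] F disj by simp
  moreover have "card F = 2" using F E_irrefl by (cases "u = v") auto
  then have "card (F \<union> \<Union> M) = 2 + 2 * card M"
    using F IH disj perfectly_matchable_finite[OF IH(1)] by (subst card_Un_disjoint) auto
  ultimately show ?case using insert by simp
qed (simp add: perfectly_matchable.empty)

text \<open>Recovers the edges from the covered set; their number then follows from
  \<open>pm_Union_matching\<close>.\<close>

lemma matching_of_pm:
  assumes "pm X"
  shows "\<exists>M. M \<subseteq> {{u, v} | u v. (u, v) \<in> E} \<and> disjoint M \<and> \<Union> M = X"
  using assms
proof (induction rule: perfectly_matchable.induct)
  case empty
  then show ?case by (intro exI[of _ "{}"]) auto
next
  case (insert_edge X u v)
  then obtain M where M: "M \<subseteq> {{u, v} | u v. (u, v) \<in> E}" "disjoint M" "\<Union> M = X" by blast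
  have "disjoint (insert {u, v} M)"
    using M insert_edge by (auto simp: disjoint_def)
  moreover have "insert {u, v} M \<subseteq> {{u, v} | u v. (u, v) \<in> E}" using M insert_edge by auto
  moreover have "\<Union> (insert {u, v} M) = insert u (insert v X)" using M by auto
  ultimately show ?case by blast
qed

end

lemma matching_number_eq_nu:
  assumes "pair_graph G"
  shows "matching_number G = nu (parcs G) (pverts G)"
proof -
  interpret pair_graph G by fact
  interpret simple_relation "parcs G" using assms by (rule pair_graph_simple_relation)
  have sub: "M \<subseteq> Pow (pverts G)" if "matching G M" for M
    using that in_arcsD1 in_arcsD2 by (fastforce simp: matching_def edges_def)
  have fin: "finite {M. matching G M}"
    by (rule finite_subset[of _ "Pow (Pow (pverts G))"]) (use sub in auto)
  have card_le: "card M \<le> nu (parcs G) (pverts G)" if M: "matching G M" for M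
  proof -
    have "finite M" using sub[OF M] by (rule finite_subset) simp
    then have "pm (\<Union> M)" "card (\<Union> M) = 2 * card M"
      using pm_Union_matching[of M] M by (auto simp: matching_def edges_def)
    moreover have "\<Union> M \<subseteq> pverts G" using sub[OF M] by blast
    ultimately show ?thesis using card_le_nu[of "pverts G" "\<Union> M"] by simp
  qed
  obtain X where X: "X \<subseteq> pverts G" "pm X" "card X = 2 * nu (parcs G) (pverts G)"
    using nu_witness[of "pverts G"] by auto
  obtain M where M: "matching G M" "\<Union> M = X"
    using matching_of_pm[OF X(2)] by (auto simp: matching_def edges_def)
  have "finite M" using sub[OF M(1)] by (rule finite_subset) simp
  then have "card M = nu (parcs G) (pverts G)"
    using pm_Union_matching[of M] M X by (auto simp: matching_def edges_def)
  then have "nu (parcs G) (pverts G) \<in> card ` {M. matching G M}"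
    using M(1) by (metis imageI mem_Collect_eq)
  then show ?thesis unfolding matching_number_def
    using card_le fin by (intro Max_eqI) auto
qed

theorem theorem3:
  fixes G :: "'a pair_pre_digraph" and t :: nat
  assumes "pair_graph G"
    and "triangle_free G"
    and "matching_number G = t"
  shows "mis G \<le> mis_bound t \<and>
    (mis G = mis_bound t \<longleftrightarrow> (\<exists>H\<in>extremal_graphs t. digraph_iso (with_proj G) (with_proj H)))"
proof -
  interpret pair_graph G by fact
  interpret simple_relation "parcs G" using assms(1) by (rule pair_graph_simple_relation)
  interpret triangle_free_relation "parcs G"
    using assms(2) by unfold_locales (unfold triangle_free_def, blast)
  have iso: "digraph_iso (with_proj G) (with_proj H) \<longleftrightarrow> induced_copy (parcs G) (pverts G) H"
    if "H \<in> extremal_graphs t" for H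
    using digraph_iso_pair_graph_iff[OF assms(1) pair_graph_extremal_graphs[OF that]]
    by (simp add: induced_copy_def)
  have "mis_bounded (pverts G)" by (rule mis_bounded) simp
  then have bound: "mis G \<le> mis_bound t"
    and eq: "mis G = mis_bound t \<Longrightarrow> extremal (parcs G) t (pverts G)"
    using assms(3) by (auto simp: mis_bounded_def mis_eq_card_mis_sets[OF assms(1)]
        matching_number_eq_nu[OF assms(1)])
  \<comment> \<open>The count is invariant under isomorphism and known for every member of the
    family with parameter t.\<close>
  have "mis G = mis_bound t" if "H \<in> extremal_graphs t" "induced_copy (parcs G) (pverts G) H" for H
    using card_mis_sets_induced_copy[OF that(2)] mis_count_extremal_graphs[OF that(1)]
    by (simp add: mis_eq_card_mis_sets[OF assms(1)])
  then show ?thesis using bound eq extremal_copy iso by blast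
qed
end
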